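(* Let $s\ge 1$. The maximum number of edges of a rooted tree of depth $s$ that is a unit rectangle visibility graph is $$-2+\left(1-\frac{3}{\sqrt{17}}\right)\left(\frac{1}{2}\left(5-\sqrt{17}\right)\right)^s+\left(1+\frac{3}{\sqrt{17}}\right)\left(\frac{1}{2}\left(5+\sqrt{17}\right)\right)^s.$$
   Context: The depth of a rooted tree is the maximum distance from the root to a vertex. A finite simple graph $G$ is a unit rectangle visibility graph (URVG) if its vertices $v$ can be represented by closed unit squares $S_v$ in the plane with sides parallel to the coordinate axes and with pairwise disjoint interiors (squares may touch along their boundaries), in such a way that two distinct vertices $v,w$ are adjacent if and only if there is an unobstructed non-degenerate (positive width) horizontal or vertical band of visibility joining $S_v$ and $S_w$. Here a horizontal band of visibility joining $S_v$ and $S_w$ is given by an open interval $I$ of positive length such that for every $y_0\in I$ the line $y=y_0$ meets the interiors of both $S_v$ and $S_w$, and the part of this line between $S_v$ and $S_w$ (possibly a single point if the squares touch) meets the interior of no other square of the representation; vertical bands are defined analogously with the roles of $x$ and $y$ exchanged. *)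

theory Defs
  imports "HOL-Analysis.Analysis"
begin

text \<open>Finite simple graphs: a vertex set together with a set of two-element edge sets.\<close>

definition simple_graph :: "'a set \<Rightarrow> 'a set set \<Rightarrow> bool" where
  "simple_graph V E \<longleftrightarrow> finite V \<and> (\<forall>e\<in>E. e \<subseteq> V \<and> card e = 2)"

definition adj :: "'a set set \<Rightarrow> ('a \<times> 'a) set" where
  "adj E = {(u, v). {u, v} \<in> E}"

definition graph_connected :: "'a set \<Rightarrow> 'a set set \<Rightarrow> bool" where
  "graph_connected V E \<longleftrightarrow> V \<noteq> {} \<and> (\<forall>u\<in>V. \<forall>v\<in>V. (u, v) \<in> (adj E)\<^sup>*)"

definition graph_cycle :: "'a set set \<Rightarrow> 'a list \<Rightarrow> bool" where
  "graph_cycle E c \<longleftrightarrow> 3 \<le> length c \<and> distinct c \<and>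
     (\<forall>i<length c. {c ! i, c ! (Suc i mod length c)} \<in> E)"

definition rooted_tree :: "'a set \<Rightarrow> 'a set set \<Rightarrow> 'a \<Rightarrow> bool" where
  "rooted_tree V E r \<longleftrightarrow> simple_graph V E \<and> graph_connected V E \<and>
     (\<nexists>c. graph_cycle E c) \<and> r \<in> V"

text \<open>The distance is the length of a shortest walk; it is only meaningful for vertices that
  are joined by some walk, which is always the case in a tree.\<close>

definition graph_dist :: "'a set set \<Rightarrow> 'a \<Rightarrow> 'a \<Rightarrow> nat" where
  "graph_dist E u v = (LEAST n. (u, v) \<in> adj E ^^ n)"

definition depth :: "'a set \<Rightarrow> 'a set set \<Rightarrow> 'a \<Rightarrow> nat" where
  "depth V E r = Max (graph_dist E r ` V)"

text \<open>The square of a vertex is given by its lower left corner.\<close>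

definition unit_square :: "real \<times> real \<Rightarrow> (real \<times> real) set" where
  "unit_square q = {fst q..fst q + 1} \<times> {snd q..snd q + 1}"

text \<open>In a horizontal band, the part of the line at height \<open>y\<close> between the two squares runs
  from the right side of the left square to the left side of the right square. (If the line meets
  both interiors and the interiors are disjoint, then the left corners are at least one unit
  apart horizontally, so this is a segment, or a single point if the squares touch.)\<close>

definition horizontal_band ::
    "'a set \<Rightarrow> ('a \<Rightarrow> real \<times> real) \<Rightarrow> 'a \<Rightarrow> 'a \<Rightarrow> bool" where
  "horizontal_band V p v w \<longleftrightarrow>
     (\<exists>a b. a < b \<and> (\<forall>y\<in>{a<..<b}.
        (\<exists>x. (x, y) \<in> interior (unit_square (p v))) \<and>
        (\<exists>x. (x, y) \<in> interior (unit_square (p w))) \<and>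
        (\<forall>x\<in>{min (fst (p v)) (fst (p w)) + 1..max (fst (p v)) (fst (p w))}.
           \<forall>u\<in>V - {v, w}. (x, y) \<notin> interior (unit_square (p u)))))"

definition vertical_band ::
    "'a set \<Rightarrow> ('a \<Rightarrow> real \<times> real) \<Rightarrow> 'a \<Rightarrow> 'a \<Rightarrow> bool" where
  "vertical_band V p v w \<longleftrightarrow>
     (\<exists>a b. a < b \<and> (\<forall>x\<in>{a<..<b}.
        (\<exists>y. (x, y) \<in> interior (unit_square (p v))) \<and>
        (\<exists>y. (x, y) \<in> interior (unit_square (p w))) \<and>
        (\<forall>y\<in>{min (snd (p v)) (snd (p w)) + 1..max (snd (p v)) (snd (p w))}.
           \<forall>u\<in>V - {v, w}. (x, y) \<notin> interior (unit_square (p u)))))"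

definition urvg :: "'a set \<Rightarrow> 'a set set \<Rightarrow> bool" where
  "urvg V E \<longleftrightarrow> simple_graph V E \<and>
     (\<exists>p.
        (\<forall>v\<in>V. \<forall>w\<in>V. v \<noteq> w \<longrightarrow>
           interior (unit_square (p v)) \<inter> interior (unit_square (p w)) = {}) \<and>
        (\<forall>v\<in>V. \<forall>w\<in>V. v \<noteq> w \<longrightarrow>
           ({v, w} \<in> E \<longleftrightarrow> horizontal_band V p v w \<or> vertical_band V p v w)))"

end

theory Submission
  imports Defs
begin

text \<open>Upper bound: In a representation of a tree, consider the horizontally visible pairs. The squares
  met by a horizontal line are linked along the line, so the line just above a square shows that,
  among the vertices at a given distance below a fixed vertex, at most one has a child placed
  higher; likewise at most one has a child placed lower. A child at the same height is unique
  (except at the start), because it hides everything on its side. So the number of vertices at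
  distance \<open>d\<close> in a monochromatic component grows by at most \<open>2\<close> with \<open>d\<close> and is at most \<open>2 d + 1\<close>.
  Counting each vertex by the monochromatic component in which it is not the top gives a linear
  recursion for the level sizes, whose solution is the formula.

  Lower bound: The recursion is attained by the tree in which every monochromatic component is a
  two-sided infinite spine with an infinite leg at each spine vertex, cut off at depth \<open>s\<close>; it can
  be laid out by placing each new square outside all earlier ones.\<close>

subsection \<open>Bands of visibility\<close>

text \<open>A degree bound alone would allow exponential growth inside a monochromatic component.
  Growth is linear because rising children exclude each other even when they have different parents:
  the walk between them stays inside the component, where every step changes the height by less than
  one, so it cannot jump over a line of unit-square width and it closes a detour around an edge.
  Acyclicity enters only in this form: every edge is a bridge. Equality in the bound dictates the
  extremal component: at each distance one rising and one falling child, which are the two ends of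
  the spine, and one level child for every other position, which gives the legs. In the formula,
  \<open>(5 - sqrt 17) / 2\<close> and \<open>(5 + sqrt 17) / 2\<close> are the roots of
  \<open>z * z = 5 * z - 2\<close>, the characteristic equation of the partial sums of the level
  sizes. The root is the top of two components, so these sums start at 2; the summand -2 removes
  that start again.\<close>

definition sees :: "'a set \<Rightarrow> ('a \<Rightarrow> real) \<Rightarrow> ('a \<Rightarrow> real) \<Rightarrow> 'a \<Rightarrow> 'a \<Rightarrow> bool" where
  "sees V x y v w \<longleftrightarrow> (\<exists>a b. a < b \<and> y v \<le> a \<and> b \<le> y v + 1 \<and> y w \<le> a \<and> b \<le> y w + 1 \<and>
     (\<forall>u\<in>V - {v, w}. min (x v) (x w) < x u \<and> x u < max (x v) (x w) \<longrightarrow> y u + 1 \<le> a \<or> b \<le> y u))"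

definition apart :: "('a \<Rightarrow> real) \<Rightarrow> ('a \<Rightarrow> real) \<Rightarrow> 'a \<Rightarrow> 'a \<Rightarrow> bool" where
  "apart x y v w \<longleftrightarrow> 1 \<le> \<bar>x v - x w\<bar> \<or> 1 \<le> \<bar>y v - y w\<bar>"

lemma sees_commute: "sees V x y v w \<longleftrightarrow> sees V x y w v"
  unfolding sees_def by (auto simp: min.commute max.commute insert_commute conj_ac)

lemma apart_swap: "apart x y v w \<longleftrightarrow> apart y x v w"
  by (auto simp: apart_def)

lemma apart_minus [simp]:
  "apart (\<lambda>v. - x v) y v w \<longleftrightarrow> apart x y v w"
  "apart x (\<lambda>v. - y v) v w \<longleftrightarrow> apart x y v w"
  by (auto simp: apart_def)

lemma sees_minus_left [simp]: "sees V (\<lambda>v. - x v) y v w \<longleftrightarrow> sees V x y v w"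
proof -
  have "min (- x v) (- x w) < - x u \<and> - x u < max (- x v) (- x w) \<longleftrightarrow>
        min (x v) (x w) < x u \<and> x u < max (x v) (x w)" for u
    by (auto simp: min_def max_def)
  then show ?thesis
    unfolding sees_def by simp
qed

lemma sees_minus_rightI: "sees V x y v w \<Longrightarrow> sees V x (\<lambda>v. - y v) v w"
  unfolding sees_def
  apply (elim exE)
  subgoal for a b by (rule exI[of _ "1 - b"], rule exI[of _ "1 - a"]) force
  done

lemma sees_minus_right [simp]: "sees V x (\<lambda>v. - y v) v w \<longleftrightarrow> sees V x y v w"
  using sees_minus_rightI[of V x y v w] sees_minus_rightI[of V x "\<lambda>v. - y v" v w] by auto

lemma sees_imp_close: "sees V x y v w \<Longrightarrow> \<bar>y v - y w\<bar> < 1"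
  unfolding sees_def by auto

lemma interior_unit_square:
  "(a, b) \<in> interior (unit_square q) \<longleftrightarrow> fst q < a \<and> a < fst q + 1 \<and> snd q < b \<and> b < snd q + 1"
  by (auto simp: unit_square_def interior_Times)

lemma disjoint_unit_squares:
  "interior (unit_square (p v)) \<inter> interior (unit_square (p w)) = {} \<longleftrightarrow>
   apart (\<lambda>u. fst (p u)) (\<lambda>u. snd (p u)) v w"
proof
  assume "interior (unit_square (p v)) \<inter> interior (unit_square (p w)) = {}"
  then have "((fst (p v) + fst (p w) + 1) / 2, (snd (p v) + snd (p w) + 1) / 2)
      \<notin> interior (unit_square (p v)) \<inter> interior (unit_square (p w))"
    by blast
  then show "apart (\<lambda>u. fst (p u)) (\<lambda>u. snd (p u)) v w"
    unfolding Int_iff interior_unit_square apart_def by (auto simp: abs_if split: if_splits)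
next
  assume "apart (\<lambda>u. fst (p u)) (\<lambda>u. snd (p u)) v w"
  then show "interior (unit_square (p v)) \<inter> interior (unit_square (p w)) = {}"
    unfolding apart_def by (auto simp: interior_unit_square)
qed

lemma Ioo_subset_Ioo_iff:
  fixes a b c d :: real
  assumes "a < b"
  shows "(\<forall>t\<in>{a<..<b}. c < t \<and> t < d) \<longleftrightarrow> c \<le> a \<and> b \<le> d"
proof
  assume H: "\<forall>t\<in>{a<..<b}. c < t \<and> t < d"
  have "{a<..<b} \<subseteq> {c<..<d}" using H by auto
  then show "c \<le> a \<and> b \<le> d"
    using assms by (simp add: greaterThanLessThan_subseteq_greaterThanLessThan)
qed auto

lemma Ioo_disjoint_unit:
  fixes a b c :: real
  assumes "a < b"
  shows "(\<forall>t\<in>{a<..<b}. \<not> (c < t \<and> t < c + 1)) \<longleftrightarrow> c + 1 \<le> a \<or> b \<le> c"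
proof
  assume H: "\<forall>t\<in>{a<..<b}. \<not> (c < t \<and> t < c + 1)"
  show "c + 1 \<le> a \<or> b \<le> c"
  proof (rule ccontr)
    assume "\<not> (c + 1 \<le> a \<or> b \<le> c)"
    then have "max a c < min b (c + 1)"
      using assms by auto
    then obtain t where "max a c < t" "t < min b (c + 1)"
      using dense by blast
    then show False using H by auto
  qed
qed auto

text \<open>Once both squares are known to meet the strip, whether \<open>u\<close> reaches into the
  gap between them does not depend on the height \<open>t\<close>. The quantifiers can therefore be
  exchanged, and an obstructing \<open>u\<close> is one whose corner lies strictly between the two
  corners.\<close>

lemma band_iff:
  fixes x y :: "'a \<Rightarrow> real"
  assumes ap: "apart x y v w"
  shows "(\<exists>a b. a < b \<and> (\<forall>t\<in>{a<..<b}. (y v < t \<and> t < y v + 1) \<and> (y w < t \<and> t < y w + 1) \<and>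
           (\<forall>z\<in>{min (x v) (x w) + 1..max (x v) (x w)}. \<forall>u\<in>V - {v, w}.
              \<not> (x u < z \<and> z < x u + 1 \<and> y u < t \<and> t < y u + 1)))) \<longleftrightarrow> sees V x y v w"
  (is "(\<exists>a b. a < b \<and> ?L a b) \<longleftrightarrow> _")
proof -
  have "?L a b \<longleftrightarrow> y v \<le> a \<and> b \<le> y v + 1 \<and> y w \<le> a \<and> b \<le> y w + 1 \<and>
     (\<forall>u\<in>V - {v, w}. min (x v) (x w) < x u \<and> x u < max (x v) (x w) \<longrightarrow> y u + 1 \<le> a \<or> b \<le> y u)"
    if "a < b" for a b
  proof (cases "y v \<le> a \<and> b \<le> y v + 1 \<and> y w \<le> a \<and> b \<le> y w + 1")
    case True
    then have "\<bar>y v - y w\<bar> < 1" using \<open>a < b\<close> by auto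
    then have le: "min (x v) (x w) + 1 \<le> max (x v) (x w)"
      using ap by (auto simp: apart_def min_def max_def)
    have mid: "(\<exists>z\<in>{min (x v) (x w) + 1..max (x v) (x w)}. x u < z \<and> z < x u + 1) \<longleftrightarrow>
          min (x v) (x w) < x u \<and> x u < max (x v) (x w)" for u
    proof
      assume "min (x v) (x w) < x u \<and> x u < max (x v) (x w)"
      then show "\<exists>z\<in>{min (x v) (x w) + 1..max (x v) (x w)}. x u < z \<and> z < x u + 1"
      proof (cases "max (x v) (x w) < x u + 1")
        case True
        then show ?thesis using le \<open>min (x v) (x w) < x u \<and> x u < max (x v) (x w)\<close>
          by (intro bexI[of _ "max (x v) (x w)"]) auto
      next
        case False
        then show ?thesis using le \<open>min (x v) (x w) < x u \<and> x u < max (x v) (x w)\<close>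
          by (intro bexI[of _ "max (min (x v) (x w) + 1) (x u + 1/2)"]) (simp_all, linarith+)
      qed
    qed auto
    have "?L a b \<longleftrightarrow> (\<forall>u\<in>V - {v, w}. \<forall>t\<in>{a<..<b}.
            (\<exists>z\<in>{min (x v) (x w) + 1..max (x v) (x w)}. x u < z \<and> z < x u + 1) \<longrightarrow>
            \<not> (y u < t \<and> t < y u + 1))"
      using True by fastforce
    also have "\<dots> \<longleftrightarrow> (\<forall>u\<in>V - {v, w}. min (x v) (x w) < x u \<and> x u < max (x v) (x w) \<longrightarrow>
            (\<forall>t\<in>{a<..<b}. \<not> (y u < t \<and> t < y u + 1)))"
      unfolding mid by blast
    also have "\<dots> \<longleftrightarrow> (\<forall>u\<in>V - {v, w}. min (x v) (x w) < x u \<and> x u < max (x v) (x w) \<longrightarrow>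
            y u + 1 \<le> a \<or> b \<le> y u)"
      unfolding Ioo_disjoint_unit[OF that] ..
    finally show ?thesis using True by blast
  next
    case False
    then have "\<not> ?L a b"
      using Ioo_subset_Ioo_iff[OF that, of "y v" "y v + 1"] Ioo_subset_Ioo_iff[OF that, of "y w" "y w + 1"]
      by blast
    then show ?thesis using False by blast
  qed
  then show ?thesis unfolding sees_def by blast
qed

lemma Ex_interval_mid: "(\<exists>t::real. c < t \<and> t < c + 1 \<and> P) \<longleftrightarrow> P"
  by (auto intro: exI[of _ "c + 1/2"])

lemma horizontal_band_iff:
  assumes "apart (\<lambda>u. fst (p u)) (\<lambda>u. snd (p u)) v w"
  shows "horizontal_band V p v w \<longleftrightarrow> sees V (\<lambda>u. fst (p u)) (\<lambda>u. snd (p u)) v w"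
  unfolding band_iff[OF assms, symmetric] horizontal_band_def interior_unit_square Ex_interval_mid ..

lemma vertical_band_iff:
  assumes "apart (\<lambda>u. fst (p u)) (\<lambda>u. snd (p u)) v w"
  shows "vertical_band V p v w \<longleftrightarrow> sees V (\<lambda>u. snd (p u)) (\<lambda>u. fst (p u)) v w"
proof -
  have "(\<exists>t. c < a \<and> a < c + 1 \<and> d < t \<and> t < d + 1) \<longleftrightarrow> c < a \<and> a < c + 1" for a c d :: real
    using Ex_interval_mid[of d "c < a \<and> a < c + 1"] by (simp add: conj_ac)
  moreover have "A \<and> B \<and> C \<and> D \<longleftrightarrow> C \<and> D \<and> A \<and> B" for A B C D
    by blast
  ultimately show ?thesis
    unfolding band_iff[OF assms[unfolded apart_swap[of "\<lambda>u. fst (p u)"]], symmetric]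
      vertical_band_def interior_unit_square fst_conv snd_conv
    by presburger
qed

lemma urvg_iff:
  "urvg V E \<longleftrightarrow> simple_graph V E \<and> (\<exists>x y. \<forall>v\<in>V. \<forall>w\<in>V. v \<noteq> w \<longrightarrow>
     apart x y v w \<and> ({v, w} \<in> E \<longleftrightarrow> sees V x y v w \<or> sees V y x v w))"
proof -
  have "(\<exists>p. (\<forall>v\<in>V. \<forall>w\<in>V. v \<noteq> w \<longrightarrow>
           interior (unit_square (p v)) \<inter> interior (unit_square (p w)) = {}) \<and>
        (\<forall>v\<in>V. \<forall>w\<in>V. v \<noteq> w \<longrightarrow>
           ({v, w} \<in> E \<longleftrightarrow> horizontal_band V p v w \<or> vertical_band V p v w))) \<longleftrightarrow>
     (\<exists>p. \<forall>v\<in>V. \<forall>w\<in>V. v \<noteq> w \<longrightarrow> apart (\<lambda>u. fst (p u)) (\<lambda>u. snd (p u)) v w \<and>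
       ({v, w} \<in> E \<longleftrightarrow> sees V (\<lambda>u. fst (p u)) (\<lambda>u. snd (p u)) v w \<or>
                       sees V (\<lambda>u. snd (p u)) (\<lambda>u. fst (p u)) v w))"
    unfolding disjoint_unit_squares
    by (intro iff_exI iffI conjI ballI impI) (simp_all add: horizontal_band_iff vertical_band_iff)
  also have "\<dots> \<longleftrightarrow> (\<exists>x y. \<forall>v\<in>V. \<forall>w\<in>V. v \<noteq> w \<longrightarrow>
     apart x y v w \<and> ({v, w} \<in> E \<longleftrightarrow> sees V x y v w \<or> sees V y x v w))"
    apply (rule iffI)
     apply blast
    apply (elim exE)
    subgoal for x y by (rule exI[of _ "\<lambda>v. (x v, y v)"]) simp
    done
  finally show ?thesis unfolding urvg_def by simp
qed

section \<open>Chains along a line and detours around an edge\<close>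

lemma strip_connected:
  fixes x y :: "'a \<Rightarrow> real"
  assumes fin: "finite V"
    and "a < b"
    and strip: "\<And>u. u \<in> V \<Longrightarrow> u \<in> S \<or> y u + 1 \<le> a \<or> b \<le> y u"
    and S: "S \<subseteq> V" "\<And>u. u \<in> S \<Longrightarrow> y u \<le> a \<and> b \<le> y u + 1"
    and "u \<in> S" "w \<in> S" "x u \<le> x w"
  shows "(u, w) \<in> {(p, q). {p, q} \<subseteq> S \<inter> {t. x u \<le> x t \<and> x t \<le> x w} \<and> p \<noteq> q \<and> sees V x y p q}\<^sup>*"
  using assms(6-)
proof (induction "card {t \<in> S. x u < x t \<and> x t < x w}" arbitrary: u w rule: less_induct)
  case less
  have finS: "finite S" using fin S(1) finite_subset by blast
  show ?case
  proof (cases "\<exists>t\<in>S. x u < x t \<and> x t < x w")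
    case True
    then obtain t where t: "t \<in> S" "x u < x t" "x t < x w" by blast
    have "{s \<in> S. x u < x s \<and> x s < x t} \<subset> {s \<in> S. x u < x s \<and> x s < x w}"
         "{s \<in> S. x t < x s \<and> x s < x w} \<subset> {s \<in> S. x u < x s \<and> x s < x w}"
      using t by auto
    then have c: "card {s \<in> S. x u < x s \<and> x s < x t} < card {s \<in> S. x u < x s \<and> x s < x w}"
              "card {s \<in> S. x t < x s \<and> x s < x w} < card {s \<in> S. x u < x s \<and> x s < x w}"
      using finS by (auto intro!: psubset_card_mono)
    have "(u, t) \<in> {(p, q). {p, q} \<subseteq> S \<inter> {s. x u \<le> x s \<and> x s \<le> x w} \<and> p \<noteq> q \<and> sees V x y p q}\<^sup>*"
      by (rule subsetD[OF rtrancl_mono less.hyps[OF c(1) less.prems(1) t(1)]]) (use t in auto)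
    moreover have "(t, w) \<in> {(p, q). {p, q} \<subseteq> S \<inter> {s. x u \<le> x s \<and> x s \<le> x w} \<and> p \<noteq> q \<and> sees V x y p q}\<^sup>*"
      by (rule subsetD[OF rtrancl_mono less.hyps[OF c(2) t(1) less.prems(2)]]) (use t in auto)
    ultimately show ?thesis by (rule rtrancl_trans)
  next
    case False
    have "sees V x y u w"
      unfolding sees_def
      by (rule exI[of _ a], rule exI[of _ b])
         (use \<open>a < b\<close> S less.prems False strip in auto)
    then show ?thesis using less.prems by (cases "u = w") (auto intro!: r_into_rtrancl)
  qed
qed

text \<open>The squares with \<open>y t \<le> c < y t + 1\<close> are those met by a line just above height \<open>c\<close>;
  using such a line makes squares whose sides lie exactly at height \<open>c\<close> unproblematic.\<close>

lemma line_connected: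
  fixes x y :: "'a \<Rightarrow> real"
  assumes fin: "finite V"
    and u: "u \<in> V" "y u \<le> c" "c < y u + 1" and w: "w \<in> V" "y w \<le> c" "c < y w + 1"
    and "x u \<le> x w"
  shows "(u, w) \<in> {(p, q). {p, q} \<subseteq> {t \<in> V. y t \<le> c \<and> c < y t + 1 \<and> x u \<le> x t \<and> x t \<le> x w}
           \<and> p \<noteq> q \<and> sees V x y p q}\<^sup>*"
proof -
  \<comment> \<open>The heights above \<open>c\<close> at which some square begins or ends. Up to
    the smallest of them the set of squares met does not change; \<open>c + 1\<close> only keeps
    \<open>D\<close> nonempty.\<close>
  define D where "D = insert (c + 1) (y ` {t \<in> V. c < y t} \<union> (\<lambda>t. y t + 1) ` {t \<in> V. c < y t + 1})"
  have D: "finite D" "D \<noteq> {}" "\<And>d. d \<in> D \<Longrightarrow> c < d"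
    unfolding D_def using fin by auto
  define b where "b = Min D"
  have "c < b" and b: "\<And>d. d \<in> D \<Longrightarrow> b \<le> d"
    unfolding b_def using D by auto
  have "(u, w) \<in> {(p, q). {p, q} \<subseteq> {t \<in> V. y t \<le> c \<and> c < y t + 1} \<inter> {t. x u \<le> x t \<and> x t \<le> x w}
           \<and> p \<noteq> q \<and> sees V x y p q}\<^sup>*"
  proof (rule strip_connected[OF fin \<open>c < b\<close>])
    show "t \<in> {t \<in> V. y t \<le> c \<and> c < y t + 1} \<or> y t + 1 \<le> c \<or> b \<le> y t" if "t \<in> V" for t
    proof (cases "c < y t")
      case True
      then have "y t \<in> D" using that by (auto simp: D_def)
      then show ?thesis using b by blast
    qed (use that in auto)
    show "y t \<le> c \<and> b \<le> y t + 1" if "t \<in> {t \<in> V. y t \<le> c \<and> c < y t + 1}" for t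
    proof -
      have "y t + 1 \<in> D" using that by (auto simp: D_def)
      then show ?thesis using b that by blast
    qed
  qed (use assms in auto)
  then show ?thesis
    by (rule subsetD[OF rtrancl_mono, rotated]) auto
qed

definition bridged :: "'a set set \<Rightarrow> bool" where
  "bridged E \<longleftrightarrow> (\<forall>u v. {u, v} \<in> E \<longrightarrow> (u, v) \<notin> (adj (E - {{u, v}}))\<^sup>*)"

text \<open>The chain visits only squares met by the line between \<open>u\<close> and
  \<open>w\<close>. If \<open>s\<close> is not among them, no edge at \<open>s\<close> is
  used.\<close>

lemma line_connected_adj:
  fixes x y :: "'a \<Rightarrow> real"
  assumes "finite V"
    and E: "\<And>v w. v \<in> V \<Longrightarrow> w \<in> V \<Longrightarrow> v \<noteq> w \<Longrightarrow> sees V x y v w \<Longrightarrow> {v, w} \<in> E"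
    and "u \<in> V" "y u \<le> c" "c < y u + 1" "w \<in> V" "y w \<le> c" "c < y w + 1" "x u \<le> x w"
    and s: "\<not> (y s \<le> c \<and> c < y s + 1 \<and> x u \<le> x s \<and> x s \<le> x w)"
  shows "(u, w) \<in> (adj (E - {{s, t}}))\<^sup>*"
  by (rule subsetD[OF rtrancl_mono line_connected[OF assms(1,3-9)]])
     (use E s in \<open>auto simp: adj_def doubleton_eq_iff\<close>)

lemma sym_adj: "sym (adj E)"
  by (auto simp: sym_def adj_def insert_commute)

lemma adj_rtrancl_sym: "(u, v) \<in> (adj E)\<^sup>* \<Longrightarrow> (v, u) \<in> (adj E)\<^sup>*"
  using sym_rtrancl[OF sym_adj] by (rule symD)

text \<open>A walk from \<open>z\<close> down to \<open>w\<close> contains a square meeting the line just above the top side of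
  \<open>w\<close>. That line also meets \<open>a\<close> but not \<open>w\<close>, so it closes a detour around the edge \<open>{w, a}\<close>.\<close>

lemma no_detour_above:
  fixes x y :: "'a \<Rightarrow> real"
  assumes "finite V"
    and E: "\<And>v w. v \<in> V \<Longrightarrow> w \<in> V \<Longrightarrow> v \<noteq> w \<Longrightarrow> sees V x y v w \<Longrightarrow> {v, w} \<in> E"
    and "bridged E" and edge: "{w, a} \<in> E" and "a \<in> V" "y w < y a" "y a < y w + 1"
    and walk: "(z, w) \<in> {(p, q). p \<in> V \<and> q \<in> V \<and> \<bar>y p - y q\<bar> < 1 \<and> {p, q} \<in> E - {{w, a}}}\<^sup>*"
    and "y w < y z"
  shows False
proof -
  \<comment> \<open>Take for \<open>p\<close> the last vertex of the walk above \<open>w\<close>: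
    its successor is not above \<open>w\<close>, and one step changes the height by less than
    1.\<close>
  have "\<exists>p\<in>V. y w < y p \<and> y p < y w + 1 \<and> (p, w) \<in> (adj (E - {{w, a}}))\<^sup>*"
    using walk \<open>y w < y z\<close>
  proof (induction rule: converse_rtrancl_induct)
    case (step p q)
    show ?case
    proof (cases "y w < y q")
      case False
      have "(q, w) \<in> (adj (E - {{w, a}}))\<^sup>*"
        by (rule subsetD[OF rtrancl_mono step(2)]) (auto simp: adj_def)
      then have "(p, w) \<in> (adj (E - {{w, a}}))\<^sup>*"
        using step(1) by (auto simp: adj_def intro: converse_rtrancl_into_rtrancl)
      then show ?thesis using False step by (intro bexI[of _ p]) auto
    qed (use step in auto)
  qed auto
  then obtain p where p: "p \<in> V" "y w < y p" "y p < y w + 1" "(p, w) \<in> (adj (E - {{w, a}}))\<^sup>*"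
    by blast
  have "(a, p) \<in> (adj (E - {{w, a}}))\<^sup>*"
  proof (cases "x a \<le> x p")
    case True
    then show ?thesis
      by (intro line_connected_adj[where V = V and x = x and y = y and c = "y w + 1"])
         (use assms p in auto)
  next
    case False
    then show ?thesis
      by (intro adj_rtrancl_sym[of p] line_connected_adj[where V = V and x = x and y = y and c = "y w + 1"])
         (use assms p in auto)
  qed
  then have "(w, a) \<in> (adj (E - {{w, a}}))\<^sup>*"
    using p(4) by (meson adj_rtrancl_sym rtrancl_trans)
  then show False using \<open>bridged E\<close> edge by (auto simp: bridged_def)
qed

text \<open>If \<open>f\<close> lies beyond \<open>e\<close>, then \<open>e\<close> hides it, since
  \<open>e\<close> fills all heights of \<open>w\<close>. If both have the same abscissa, they
  overlap. If \<open>f\<close> comes first, a line meeting both links \<open>f\<close> to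
  \<open>e\<close> to the right of \<open>w\<close>, a detour around the edge from \<open>w\<close>
  to \<open>e\<close>.\<close>

lemma level_neighbour_right:
  fixes x y :: "'a \<Rightarrow> real"
  assumes "finite V"
    and ap: "\<And>v w. v \<in> V \<Longrightarrow> w \<in> V \<Longrightarrow> v \<noteq> w \<Longrightarrow> apart x y v w"
    and E: "\<And>v w. v \<in> V \<Longrightarrow> w \<in> V \<Longrightarrow> v \<noteq> w \<Longrightarrow> sees V x y v w \<Longrightarrow> {v, w} \<in> E"
    and "bridged E" and V: "w \<in> V" "e \<in> V" "f \<in> V" and "e \<noteq> f"
    and e: "sees V x y w e" "y e = y w" "x w < x e"
    and f: "sees V x y w f" "x w < x f"
  shows False
proof -
  have yf: "\<bar>y w - y f\<bar> < 1" using sees_imp_close f by metis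
  have ne: "e \<noteq> w" "f \<noteq> w" using e f by auto
  consider "x e < x f" | "x f = x e" | "x f < x e" by linarith
  then show False
  proof cases
    case 1
    then show False using f e ne \<open>e \<noteq> f\<close> V unfolding sees_def by fastforce
  next
    case 2
    then show False using ap[OF V(2,3) \<open>e \<noteq> f\<close>] yf e by (auto simp: apart_def)
  next
    case 3
    have "(f, e) \<in> (adj (E - {{w, e}}))\<^sup>*"
      by (rule line_connected_adj[where V = V and x = x and y = y and c = "max (y w) (y f)"])
         (use assms 3 yf in auto)
    moreover have "(w, f) \<in> adj (E - {{w, e}})"
      using E[OF V(1,3)] ne f \<open>e \<noteq> f\<close> by (auto simp: adj_def doubleton_eq_iff)
    ultimately have "(w, e) \<in> (adj (E - {{w, e}}))\<^sup>*"
      by (rule converse_rtrancl_into_rtrancl[rotated])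
    moreover have "{w, e} \<in> E" using E[OF V(1,2)] ne e by auto
    ultimately show False using \<open>bridged E\<close> by (auto simp: bridged_def)
  qed
qed

lemma level_neighbour_opposite:
  fixes x y :: "'a \<Rightarrow> real"
  assumes fin: "finite V"
    and ap: "\<And>v w. v \<in> V \<Longrightarrow> w \<in> V \<Longrightarrow> v \<noteq> w \<Longrightarrow> apart x y v w"
    and E: "\<And>v w. v \<in> V \<Longrightarrow> w \<in> V \<Longrightarrow> v \<noteq> w \<Longrightarrow> sees V x y v w \<Longrightarrow> {v, w} \<in> E"
    and br: "bridged E" and V: "w \<in> V" "e \<in> V" "f \<in> V" and ne: "e \<noteq> f" "e \<noteq> w" "f \<noteq> w"
    and e: "sees V x y w e" "y e = y w" and f: "sees V x y w f"
  shows "x e < x w \<and> x w < x f \<or> x f < x w \<and> x w < x e"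
proof -
  have n: "x e \<noteq> x w" "x f \<noteq> x w"
    using ap[OF V(1,2)] ap[OF V(1,3)] ne sees_imp_close[OF e(1)] sees_imp_close[OF f]
    by (auto simp: apart_def)
  have "\<not> (x w < x e \<and> x w < x f)"
    using level_neighbour_right[OF fin ap E br V ne(1) e _ f] by blast
  moreover have "\<not> (x e < x w \<and> x f < x w)"
    using level_neighbour_right[of V "\<lambda>v. - x v" y E w e f] assms by auto
  ultimately show ?thesis using n by linarith
qed

subsection \<open>Rooted trees and monochromatic descendants\<close>

lemma rtrancl_imp_distinct_path:
  assumes "(u, v) \<in> R\<^sup>*"
  shows "\<exists>xs. xs \<noteq> [] \<and> hd xs = u \<and> last xs = v \<and> distinct xs \<and> successively (\<lambda>p q. (p, q) \<in> R) xs"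
  using assms
proof (induction rule: converse_rtrancl_induct)
  case base
  show ?case by (intro exI[of _ "[v]"]) auto
next
  case (step u z)
  then obtain xs where xs: "xs \<noteq> []" "hd xs = z" "last xs = v" "distinct xs"
    "successively (\<lambda>p q. (p, q) \<in> R) xs" by blast
  show ?case
  proof (cases "u \<in> set xs")
    case True
    then obtain ys zs where "xs = ys @ u # zs" by (auto dest: split_list)
    then show ?thesis
      using xs by (intro exI[of _ "u # zs"]) (auto simp: successively_append_iff)
  next
    case False
    then show ?thesis
      using xs step(1) by (intro exI[of _ "u # xs"]) (auto simp: successively_Cons)
  qed
qed

lemma acyclic_imp_bridged:
  assumes E: "simple_graph V E" and nocycle: "\<nexists>c. graph_cycle E c"
  shows "bridged E"
  unfolding bridged_def
proof (intro allI impI notI)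
  fix u v
  assume uv: "{u, v} \<in> E" and conn: "(u, v) \<in> (adj (E - {{u, v}}))\<^sup>*"
  obtain xs where xs: "xs \<noteq> []" "hd xs = u" "last xs = v" "distinct xs"
    "successively (\<lambda>p q. (p, q) \<in> adj (E - {{u, v}})) xs"
    using rtrancl_imp_distinct_path[OF conn] by (elim exE conjE)
  have "u \<noteq> v" using uv E by (auto simp: simple_graph_def)
  have step: "{xs ! i, xs ! Suc i} \<in> E - {{u, v}}" if "Suc i < length xs" for i
    using xs(5) that by (auto simp: successively_conv_nth adj_def)
  have ends: "xs ! 0 = u" "xs ! (length xs - 1) = v"
    using xs by (simp_all add: hd_conv_nth last_conv_nth)
  have "length xs \<noteq> 1" using ends \<open>u \<noteq> v\<close> by auto
  moreover have "length xs \<noteq> 2" using ends step[of 0] by auto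
  ultimately have "3 \<le> length xs"
    using xs(1) by (cases "length xs") auto
  moreover have "{xs ! i, xs ! (Suc i mod length xs)} \<in> E" if "i < length xs" for i
  proof (cases "Suc i = length xs")
    case True
    then show ?thesis using ends uv by (simp flip: True) (simp add: insert_commute)
  next
    case False
    then show ?thesis using step[of i] that by simp
  qed
  ultimately show False using nocycle xs(4) by (auto simp: graph_cycle_def)
qed

lemma parent_connected:
  fixes lev :: "'a \<Rightarrow> nat"
  assumes par: "\<And>v. v \<in> V - {r} \<Longrightarrow> par v \<in> V \<and> lev v = Suc (lev (par v))" and "v \<in> V"
  shows "(v, r) \<in> (adj ((\<lambda>v. {v, par v}) ` (V - {r})))\<^sup>*"
  using \<open>v \<in> V\<close>
proof (induction "lev v" arbitrary: v rule: less_induct)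
  case less
  show ?case
  proof (cases "v = r")
    case False
    then have "(v, par v) \<in> adj ((\<lambda>v. {v, par v}) ` (V - {r}))"
      "(par v, r) \<in> (adj ((\<lambda>v. {v, par v}) ` (V - {r})))\<^sup>*"
      using less par[of v] by (auto simp: adj_def)
    then show ?thesis by (rule converse_rtrancl_into_rtrancl)
  qed auto
qed

lemma rooted_tree_parent:
  assumes tree: "rooted_tree V E r"
  obtains par where
    "\<And>v. v \<in> V - {r} \<Longrightarrow> par v \<in> V \<and> {v, par v} \<in> E \<and>
       graph_dist E r v = Suc (graph_dist E r (par v))"
    "E = (\<lambda>v. {v, par v}) ` (V - {r})"
proof -
  let ?d = "graph_dist E r"
  have E: "simple_graph V E" and r: "r \<in> V" and br: "bridged E"
    and conn: "\<And>v. v \<in> V \<Longrightarrow> (r, v) \<in> (adj E)\<^sup>*"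
    using tree acyclic_imp_bridged[of V E] by (auto simp: rooted_tree_def graph_connected_def)
  have inV: "u \<in> V" "v \<in> V" if "{u, v} \<in> E" for u v
    using E that by (auto simp: simple_graph_def)
  have "\<exists>u\<in>V. {v, u} \<in> E \<and> ?d v = Suc (?d u)" if v: "v \<in> V - {r}" for v
  proof -
    obtain n where "(r, v) \<in> adj E ^^ n"
      using conn v rtrancl_imp_relpow by blast
    then have walk: "(r, v) \<in> adj E ^^ ?d v"
      unfolding graph_dist_def by (rule LeastI)
    have "?d v \<noteq> 0" using walk v by (intro notI) auto
    then obtain k where k: "?d v = Suc k" by (cases "?d v") auto
    with walk obtain u where u: "(r, u) \<in> adj E ^^ k" "(u, v) \<in> adj E" by auto
    have le: "?d u \<le> k" unfolding graph_dist_def using u(1) by (rule Least_le)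
    have "(r, u) \<in> adj E ^^ ?d u"
      unfolding graph_dist_def using u(1) by (rule LeastI)
    then have "(r, v) \<in> adj E ^^ Suc (?d u)" using u(2) by auto
    then have "?d v \<le> Suc (?d u)" unfolding graph_dist_def by (rule Least_le)
    then have "?d v = Suc (?d u)" using le k by simp
    moreover have "{v, u} \<in> E" using u(2) by (simp add: adj_def insert_commute)
    ultimately show ?thesis using inV by blast
  qed
  then obtain par where par: "\<And>v. v \<in> V - {r} \<Longrightarrow> par v \<in> V \<and> {v, par v} \<in> E \<and> ?d v = Suc (?d (par v))"
    by metis
  define F where "F = (\<lambda>v. {v, par v}) ` (V - {r})"
  have toroot: "(v, r) \<in> (adj F)\<^sup>*" if "v \<in> V" for v
    unfolding F_def by (rule parent_connected[where lev = ?d]) (use par that in auto)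
  have "E = F"
  proof
    show "F \<subseteq> E" using par by (auto simp: F_def)
    show "E \<subseteq> F"
    \<comment> \<open>The parent edges already connect both ends of any further edge through the
      root, so that edge would not be a bridge.\<close>
    proof (rule ccontr)
      assume "\<not> E \<subseteq> F"
      then obtain e where e: "e \<in> E" "e \<notin> F" by blast
      then obtain u v where uv: "e = {u, v}"
        using E by (auto simp: simple_graph_def card_2_iff)
      have "(u, v) \<in> (adj F)\<^sup>*"
        using toroot inV[of u v] e uv by (meson adj_rtrancl_sym rtrancl_trans)
      moreover have "adj F \<subseteq> adj (E - {{u, v}})"
        using \<open>F \<subseteq> E\<close> e uv by (auto simp: adj_def)
      ultimately show False
        using br e uv rtrancl_mono unfolding bridged_def by blast
    qed
  qed
  then show thesis using that par unfolding F_def by blast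
qed

text \<open>\<open>W\<close> is the set of vertices whose parent edge has a given colour (horizontal or vertical), so
  \<open>desc par W v d\<close> consists of the vertices reached from \<open>v\<close> by \<open>d\<close> downward edges of that
  colour.\<close>

primrec desc :: "('a \<Rightarrow> 'a) \<Rightarrow> 'a set \<Rightarrow> 'a \<Rightarrow> nat \<Rightarrow> 'a set" where
  "desc par W v 0 = {v}"
| "desc par W v (Suc d) = {w \<in> W. par w \<in> desc par W v d}"

locale tree_rep =
  fixes V :: "'a set" and E :: "'a set set" and r :: 'a and par :: "'a \<Rightarrow> 'a" and lev :: "'a \<Rightarrow> nat"
    and x y :: "'a \<Rightarrow> real"
  assumes fin: "finite V"
    and root: "r \<in> V"
    and bridged: "bridged E"
    and par: "\<And>v. v \<in> V - {r} \<Longrightarrow> par v \<in> V"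
    and par_edge: "\<And>v. v \<in> V - {r} \<Longrightarrow> {v, par v} \<in> E"
    and par_lev: "\<And>v. v \<in> V - {r} \<Longrightarrow> lev v = Suc (lev (par v))"
    and apart: "\<And>v w. v \<in> V \<Longrightarrow> w \<in> V \<Longrightarrow> v \<noteq> w \<Longrightarrow> apart x y v w"
    and sees_edge: "\<And>v w. v \<in> V \<Longrightarrow> w \<in> V \<Longrightarrow> v \<noteq> w \<Longrightarrow> sees V x y v w \<Longrightarrow> {v, w} \<in> E"
begin

lemma desc_lev:
  assumes "W \<subseteq> V - {r}" "w \<in> desc par W v d"
  shows "lev w = lev v + d"
  using assms(2)
proof (induction d arbitrary: w)
  case (Suc d)
  then show ?case using par_lev[of w] assms(1) by auto
qed auto

lemma desc_subset: "W \<subseteq> V - {r} \<Longrightarrow> v \<in> V \<Longrightarrow> desc par W v d \<subseteq> V"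
  by (cases d) auto

lemma finite_desc: "W \<subseteq> V - {r} \<Longrightarrow> v \<in> V \<Longrightarrow> finite (desc par W v d)"
  by (rule finite_subset[OF desc_subset fin])

text \<open>Levels drop strictly on the way up, so a walk that starts at most as deep as
  \<open>a\<close>, but not at \<open>a\<close>, never passes through \<open>a\<close> and avoids
  its parent edge.\<close>

lemma desc_walk:
  assumes W: "W \<subseteq> V - {r}" "\<And>w. w \<in> W \<Longrightarrow> sees V x y w (par w)"
    and a: "a \<in> W" and w: "w \<in> desc par W v d" "w \<noteq> a" "lev w \<le> lev a"
  shows "(w, v) \<in> {(p, q). p \<in> V \<and> q \<in> V \<and> \<bar>y p - y q\<bar> < 1 \<and> {p, q} \<in> E - {{par a, a}}}\<^sup>*"
  using w
proof (induction d arbitrary: w)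
  case (Suc d)
  then have w: "w \<in> V - {r}" "w \<in> W" "par w \<in> desc par W v d" using W by auto
  have l: "lev w = Suc (lev (par w))" "lev a = Suc (lev (par a))"
    using par_lev w a W by auto
  then have "{w, par w} \<noteq> {par a, a}" using Suc.prems by (auto simp: doubleton_eq_iff)
  then have "(w, par w) \<in> {(p, q). p \<in> V \<and> q \<in> V \<and> \<bar>y p - y q\<bar> < 1 \<and> {p, q} \<in> E - {{par a, a}}}"
    using w par par_edge sees_imp_close[OF W(2)[OF w(2)]] by auto
  moreover have "(par w, v) \<in> {(p, q). p \<in> V \<and> q \<in> V \<and> \<bar>y p - y q\<bar> < 1 \<and> {p, q} \<in> E - {{par a, a}}}\<^sup>*"
    using Suc.IH[OF w(3)] l Suc.prems by fastforce
  ultimately show ?case by (rule converse_rtrancl_into_rtrancl)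
qed auto

text \<open>Of two rising vertices let \<open>a\<close> be the one with the lower parent. The other
  one, \<open>b\<close>, then lies above \<open>par a\<close>, and the walk from \<open>b\<close> up
  to \<open>v\<close> and down to \<open>par a\<close> avoids the edge from \<open>par a\<close> to
  \<open>a\<close>, which \<open>no_detour_above\<close> forbids.\<close>

lemma at_most_one_rising:
  assumes W: "W \<subseteq> V - {r}" "\<And>w. w \<in> W \<Longrightarrow> sees V x y w (par w)" and v: "v \<in> V"
  shows "card {w \<in> desc par W v (Suc d). y (par w) < y w} \<le> 1"
proof -
  let ?S = "\<lambda>a. {(p, q). p \<in> V \<and> q \<in> V \<and> \<bar>y p - y q\<bar> < 1 \<and> {p, q} \<in> E - {{par a, a}}}"
  have le: "a = b"
    if a: "a \<in> desc par W v (Suc d)" "y (par a) < y a" and b: "b \<in> desc par W v (Suc d)" "y (par b) < y b"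
      and "y (par a) \<le> y (par b)" for a b
  proof (rule ccontr)
    assume "a \<noteq> b"
    have aW: "a \<in> W" "a \<in> V - {r}" "par a \<in> desc par W v d" using a W by auto
    have la: "lev a = lev b" "lev a = Suc (lev (par a))"
      using desc_lev[OF W(1)] a(1) b(1) par_lev aW by metis+
    have "sym (?S a)" by (auto simp: sym_def insert_commute)
    then have sym: "sym ((?S a)\<^sup>*)" by (rule sym_rtrancl)
    have "(b, v) \<in> (?S a)\<^sup>*"
      using desc_walk[OF W aW(1) b(1)] \<open>a \<noteq> b\<close> la by simp
    moreover have "(v, par a) \<in> (?S a)\<^sup>*"
    proof (rule symD[OF sym desc_walk[OF W aW(1,3)]])
      show "par a \<noteq> a" using la(2) by (metis n_not_Suc_n)
      show "lev (par a) \<le> lev a" using la(2) by linarith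
    qed
    ultimately have "(b, par a) \<in> (?S a)\<^sup>*" by (rule rtrancl_trans)
    moreover have "{par a, a} \<in> E" using par_edge[OF aW(2)] by (simp add: insert_commute)
    moreover have "y a < y (par a) + 1" using sees_imp_close[OF W(2)[OF aW(1)]] by simp
    ultimately show False
      by (intro no_detour_above[of V x y E "par a" a b])
         (use fin sees_edge bridged a b aW \<open>y (par a) \<le> y (par b)\<close> in auto)
  qed
  have "a = b"
    if "a \<in> desc par W v (Suc d)" "y (par a) < y a" "b \<in> desc par W v (Suc d)" "y (par b) < y b" for a b
    using linear[of "y (par a)" "y (par b)"] le[of a b] le[of b a] that by (elim disjE) simp_all
  moreover have "finite {w \<in> desc par W v (Suc d). y (par w) < y w}"
    by (rule finite_subset[OF _ finite_desc[OF W(1) v, of "Suc d"]]) auto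
  ultimately show ?thesis
    by (auto simp: card_le_Suc0_iff_eq simp del: desc.simps)
qed

lemma tree_rep_minus: "tree_rep V E r par lev x (\<lambda>v. - y v)"
  using tree_rep_axioms by (simp add: tree_rep_def)

lemma at_most_one_falling:
  assumes "W \<subseteq> V - {r}" "\<And>w. w \<in> W \<Longrightarrow> sees V x y w (par w)" "v \<in> V"
  shows "card {w \<in> desc par W v (Suc d). y w < y (par w)} \<le> 1"
  using tree_rep.at_most_one_rising[OF tree_rep_minus, of W v d] assms by simp

lemma level_opposite:
  assumes "u \<in> V" "e \<in> V" "f \<in> V" "e \<noteq> f" "e \<noteq> u" "f \<noteq> u" "sees V x y u e" "y e = y u" "sees V x y u f"
  shows "x e < x u \<and> x u < x f \<or> x f < x u \<and> x u < x e"
  by (rule level_neighbour_opposite[of V x y E u e f])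
     (use fin apart sees_edge bridged assms in auto)

lemma card_desc_split:
  assumes W: "W \<subseteq> V - {r}" "\<And>w. w \<in> W \<Longrightarrow> sees V x y w (par w)" and v: "v \<in> V"
  shows "card (desc par W v (Suc d)) \<le> card {w \<in> desc par W v (Suc d). y w = y (par w)} + 2"
proof -
  let ?D = "desc par W v (Suc d)"
  have "card ?D = card ({w \<in> ?D. y w = y (par w)} \<union>
      ({w \<in> ?D. y (par w) < y w} \<union> {w \<in> ?D. y w < y (par w)}))"
    by (rule arg_cong[where f = card]) (auto simp del: desc.simps)
  also have "\<dots> \<le> card {w \<in> ?D. y w = y (par w)} +
      (card {w \<in> ?D. y (par w) < y w} + card {w \<in> ?D. y w < y (par w)})"
    by (rule order_trans[OF card_Un_le add_left_mono[OF card_Un_le]])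
  finally have "card ?D \<le> card {w \<in> ?D. y w = y (par w)} +
      (card {w \<in> ?D. y (par w) < y w} + card {w \<in> ?D. y w < y (par w)})" .
  then show ?thesis
    using at_most_one_rising[OF W v, of d] at_most_one_falling[OF W v, of d] by linarith
qed

lemma child_props:
  assumes "W \<subseteq> V - {r}" "\<And>w. w \<in> W \<Longrightarrow> sees V x y w (par w)" "w \<in> W"
  shows "w \<in> V" "par w \<in> V" "w \<noteq> par w" "sees V x y (par w) w" "lev w = Suc (lev (par w))"
proof -
  have "w \<in> V - {r}" using assms by auto
  then show "w \<in> V" "par w \<in> V" "w \<noteq> par w" "sees V x y (par w) w" "lev w = Suc (lev (par w))"
    using par[of w] par_lev[of w] assms(2)[OF assms(3)] sees_commute[of V x y] by auto
qed

text \<open>Two level children of the top occupy both of its sides and hide everything else, so the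
  count is then 2. Otherwise there is at most one level, one rising and one falling child.\<close>

lemma card_desc_1:
  assumes W: "W \<subseteq> V - {r}" "\<And>w. w \<in> W \<Longrightarrow> sees V x y w (par w)" and v: "v \<in> V"
  shows "card (desc par W v (Suc 0)) \<le> 3"
proof -
  let ?L = "{w \<in> desc par W v (Suc 0). y w = y (par w)}"
  show ?thesis
  proof (cases "card ?L \<le> 1")
    case True
    then show ?thesis using card_desc_split[OF W v, of 0] by linarith
  next
    case False
    have "finite ?L" by (rule finite_subset[OF _ finite_desc[OF W(1) v, of "Suc 0"]]) auto
    with False obtain e f where ef: "e \<in> ?L" "f \<in> ?L" "e \<noteq> f"
      by (auto simp: card_le_Suc0_iff_eq simp del: desc.simps)
    have "w \<in> {e, f}" if w: "w \<in> desc par W v (Suc 0)" for w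
    proof (rule ccontr)
      assume "w \<notin> {e, f}"
      have "v \<in> V" "e \<in> W" "f \<in> W" "w \<in> W" and p: "par e = v" "par f = v" "par w = v"
        using ef w v by auto
      note c = child_props[OF W \<open>e \<in> W\<close>] child_props[OF W \<open>f \<in> W\<close>] child_props[OF W \<open>w \<in> W\<close>]
      have "x e < x v \<and> x v < x f \<or> x f < x v \<and> x v < x e" "x e < x v \<and> x v < x w \<or> x w < x v \<and> x v < x e"
        "x f < x v \<and> x v < x w \<or> x w < x v \<and> x v < x f"
        by (rule level_opposite; use c p ef \<open>w \<notin> {e, f}\<close> in \<open>auto simp del: desc.simps\<close>)+
      then show False by linarith
    qed
    then have "card (desc par W v (Suc 0)) \<le> card {e, f}"
      by (intro card_mono) auto
    also have "\<dots> \<le> 3" by (simp add: card_insert_if)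
    finally show ?thesis .
  qed
qed

text \<open>For \<open>0 < d\<close> a vertex at distance \<open>d\<close> also sees its own parent.
  Two level children and that parent would have to lie pairwise on opposite sides, which is
  impossible; so level children inject into their parents.\<close>

lemma card_desc_Suc:
  assumes W: "W \<subseteq> V - {r}" "\<And>w. w \<in> W \<Longrightarrow> sees V x y w (par w)" and v: "v \<in> V" and "0 < d"
  shows "card (desc par W v (Suc d)) \<le> card (desc par W v d) + 2"
proof -
  let ?L = "{w \<in> desc par W v (Suc d). y w = y (par w)}"
  have "inj_on par ?L"
  proof (rule inj_onI, rule ccontr)
    fix e f assume ef: "e \<in> ?L" "f \<in> ?L" "par e = par f" "e \<noteq> f"
    let ?u = "par e"
    have "?u \<in> desc par W v d" using ef by auto
    then have u: "?u \<in> W" using \<open>0 < d\<close> by (cases d) auto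
    have "e \<in> W" "f \<in> W" using ef by auto
    note c = child_props[OF W \<open>e \<in> W\<close>] child_props[OF W \<open>f \<in> W\<close>] child_props[OF W u]
    have "lev e \<noteq> lev (par ?u)" "lev f \<noteq> lev (par ?u)"
      using c(5,10,15) arg_cong[OF ef(3), of lev] by linarith+
    then have ne: "e \<noteq> par ?u" "f \<noteq> par ?u" by metis+
    have "x e < x ?u \<and> x ?u < x f \<or> x f < x ?u \<and> x ?u < x e"
      "x e < x ?u \<and> x ?u < x (par ?u) \<or> x (par ?u) < x ?u \<and> x ?u < x e"
      "x f < x ?u \<and> x ?u < x (par ?u) \<or> x (par ?u) < x ?u \<and> x ?u < x f"
      by (rule level_opposite; use c(1-4,6-9,11-14) ef ne W(2)[OF u] in \<open>auto simp del: desc.simps\<close>)+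
    then show False by linarith
  qed
  then have "card ?L \<le> card (desc par W v d)"
    by (intro card_inj_on_le[OF _ _ finite_desc[OF W(1) v]]) auto
  then show ?thesis using card_desc_split[OF W v, of d] by linarith
qed

lemma card_desc_le:
  assumes "W \<subseteq> V - {r}" "\<And>w. w \<in> W \<Longrightarrow> sees V x y w (par w)" "v \<in> V"
  shows "card (desc par W v d) \<le> 2 * d + 1"
proof (induction d)
  case (Suc d)
  then show ?case
    using card_desc_1[OF assms] card_desc_Suc[OF assms, of d] by (cases "d = 0") auto
qed auto

end

text \<open>A vertex at level \<open>n > 0\<close> lies below the top of its monochromatic component, at level
  \<open>m < n\<close>, and there are at most \<open>2 (n - m) + 1\<close> vertices of the component at that level. Every
  vertex is the top of one component, except that the root is the top of two; hence the value
  \<open>2\<close> at \<open>0\<close>.\<close>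

fun top_count :: "nat \<Rightarrow> nat" where
  "top_count n = (if n = 0 then 2 else \<Sum>m<n. top_count m * (2 * (n - m) + 1))"

declare top_count.simps [simp del]

text \<open>\<open>(c, v)\<close> stands for the component of colour \<open>c\<close> whose top vertex is \<open>v\<close>.\<close>

definition tops :: "'a set \<Rightarrow> 'a \<Rightarrow> ('a \<Rightarrow> nat) \<Rightarrow> (bool \<Rightarrow> 'a set) \<Rightarrow> nat \<Rightarrow> (bool \<times> 'a) set" where
  "tops V r lev W n = {(c, v). v \<in> V \<and> lev v = n \<and> (v = r \<or> v \<in> W (\<not> c))}"

text \<open>Climb while the parent edge keeps the colour \<open>c\<close>; the climb ends at the
  root or at a vertex whose parent edge has the other colour.\<close>

lemma level_cover:
  fixes lev :: "'a \<Rightarrow> nat"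
  assumes par: "\<And>v. v \<in> V - {r} \<Longrightarrow> par v \<in> V \<and> lev v = Suc (lev (par v))"
    and W: "W True \<union> W False = V - {r}"
    and w: "w \<in> W c"
  shows "\<exists>m < lev w. \<exists>v. (c, v) \<in> tops V r lev W m \<and> w \<in> desc par (W c) v (lev w - m)"
  using w
proof (induction "lev w" arbitrary: w rule: less_induct)
  case less
  have wV: "w \<in> V - {r}" using less.prems W by (cases c) auto
  note p = par[OF wV]
  show ?case
  proof (cases "par w \<in> W c")
    case True
    then obtain m v where m: "m < lev (par w)" "(c, v) \<in> tops V r lev W m"
      "par w \<in> desc par (W c) v (lev (par w) - m)"
      using less.hyps[of "par w"] p by auto
    then have "w \<in> desc par (W c) v (lev w - m)"
      using p less.prems by (simp add: Suc_diff_le)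
    then show ?thesis using m p by (intro exI[of _ m]) auto
  next
    case False
    have "par w = r \<or> par w \<in> W True \<union> W False" using p unfolding W by auto
    then have "par w = r \<or> par w \<in> W (\<not> c)" using False by (cases c) auto
    then have "(c, par w) \<in> tops V r lev W (lev (par w))" using p by (auto simp: tops_def)
    then show ?thesis using p less.prems by (intro exI[of _ "lev (par w)"]) auto
  qed
qed

lemma card_tops:
  assumes W: "W True \<union> W False = V - {r}" "W True \<inter> W False = {}" and r: "lev r = 0" and "0 < n"
  shows "card (tops V r lev W n) = card {v \<in> V. lev v = n}"
proof -
  have "bij_betw snd (tops V r lev W n) {v \<in> V. lev v = n}"
  proof (rule bij_betwI')
    fix p q assume pq: "p \<in> tops V r lev W n" "q \<in> tops V r lev W n"
    obtain c v d w where [simp]: "p = (c, v)" "q = (d, w)" by (cases p, cases q)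
    show "(snd p = snd q) \<longleftrightarrow> (p = q)"
      using pq W r \<open>0 < n\<close> by (cases c; cases d) (auto simp: tops_def)
  next
    fix p assume "p \<in> tops V r lev W n"
    then show "snd p \<in> {v \<in> V. lev v = n}" by (auto simp: tops_def)
  next
    fix v assume v: "v \<in> {v \<in> V. lev v = n}"
    then have "v \<in> W True \<union> W False" using W r \<open>0 < n\<close> by auto
    then obtain c where "v \<in> W (\<not> c)" by (metis (full_types) Un_iff)
    then show "\<exists>p\<in>tops V r lev W n. v = snd p"
      using v by (intro bexI[of _ "(c, v)"]) (auto simp: tops_def)
  qed
  then show ?thesis by (rule bij_betw_same_card)
qed

lemma card_tops_le:
  fixes V :: "'a set" and lev :: "'a \<Rightarrow> nat"
  assumes fin: "finite V" and r: "lev r = 0"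
    and par: "\<And>v. v \<in> V - {r} \<Longrightarrow> par v \<in> V \<and> lev v = Suc (lev (par v))"
    and W: "W True \<union> W False = V - {r}" "W True \<inter> W False = {}"
    and desc: "\<And>c v d. v \<in> V \<Longrightarrow> card (desc par (W c) v d) \<le> 2 * d + 1"
  shows "card (tops V r lev W n) \<le> top_count n"
proof (induction n rule: less_induct)
  case (less n)
  have finT: "finite (tops V r lev W m)" for m
    by (rule finite_subset[of _ "UNIV \<times> V"]) (auto simp: tops_def fin)
  have Wc: "W c \<subseteq> V - {r}" for c using W(1) by (cases c) auto
  show ?case
  proof (cases "n = 0")
    case True
    have "tops V r lev W n \<subseteq> {(True, r), (False, r)}"
    proof
      fix p assume p: "p \<in> tops V r lev W n"
      then have "snd p = r"
        using par[of "snd p"] True by (cases "snd p = r") (auto simp: tops_def)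
      then show "p \<in> {(True, r), (False, r)}" by (cases p; cases "fst p") auto
    qed
    then have "card (tops V r lev W n) \<le> card {(True, r), (False, r)}"
      by (intro card_mono) auto
    then show ?thesis using True by (simp add: top_count.simps)
  next
    case False
    have "{v \<in> V. lev v = n} \<subseteq> (\<Union>m<n. \<Union>(c, v)\<in>tops V r lev W m. desc par (W c) v (n - m))"
    proof
      fix w assume w: "w \<in> {v \<in> V. lev v = n}"
      then have "w \<in> W True \<union> W False" using False W r by auto
      then obtain c where "w \<in> W c" by blast
      then show "w \<in> (\<Union>m<n. \<Union>(c, v)\<in>tops V r lev W m. desc par (W c) v (n - m))"
        using level_cover[where lev = lev, OF par W(1)] w by fast
    qed
    moreover have "finite (\<Union>m<n. \<Union>(c, v)\<in>tops V r lev W m. desc par (W c) v (n - m))"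
    proof (intro finite_UN_I finT)
      fix m p assume "m \<in> {..<n}" "p \<in> tops V r lev W m"
      then have "desc par (W (fst p)) (snd p) (n - m) \<subseteq> V"
        using Wc by (cases "n - m") auto
      then show "finite (case p of (c, v) \<Rightarrow> desc par (W c) v (n - m))"
        using fin finite_subset by (auto simp: case_prod_beta)
    qed auto
    ultimately have "card {v \<in> V. lev v = n}
        \<le> card (\<Union>m<n. \<Union>(c, v)\<in>tops V r lev W m. desc par (W c) v (n - m))"
      by (rule card_mono[rotated])
    also have "\<dots> \<le> (\<Sum>m<n. card (\<Union>(c, v)\<in>tops V r lev W m. desc par (W c) v (n - m)))"
      by (rule card_UN_le) auto
    also have "\<dots> \<le> (\<Sum>m<n. \<Sum>(c, v)\<in>tops V r lev W m. card (desc par (W c) v (n - m)))"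
      unfolding case_prod_beta by (intro sum_mono card_UN_le finT)
    also have "\<dots> \<le> (\<Sum>m<n. \<Sum>p\<in>tops V r lev W m. 2 * (n - m) + 1)"
      unfolding case_prod_beta by (intro sum_mono desc) (auto simp: tops_def)
    also have "\<dots> = (\<Sum>m<n. card (tops V r lev W m) * (2 * (n - m) + 1))"
      by simp
    also have "\<dots> \<le> (\<Sum>m<n. top_count m * (2 * (n - m) + 1))"
      by (intro sum_mono mult_right_mono less.IH) auto
    also have "\<dots> = top_count n" using False by (simp add: top_count.simps)
    finally show ?thesis using card_tops[where lev = lev, OF W r] False by simp
  qed
qed

lemma urvg_card_le:
  fixes V :: "'a set"
  assumes tree: "rooted_tree V E r" and u: "urvg V E"
  shows "card E \<le> (\<Sum>n=1..depth V E r. top_count n)"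
proof -
  let ?lev = "graph_dist E r"
  obtain par where par: "\<And>v. v \<in> V - {r} \<Longrightarrow> par v \<in> V \<and> {v, par v} \<in> E \<and> ?lev v = Suc (?lev (par v))"
    and E: "E = (\<lambda>v. {v, par v}) ` (V - {r})"
    by (rule rooted_tree_parent[OF tree]) (rule that)
  obtain x y where xy: "\<And>v w. v \<in> V \<Longrightarrow> w \<in> V \<Longrightarrow> v \<noteq> w \<Longrightarrow>
     apart x y v w \<and> ({v, w} \<in> E \<longleftrightarrow> sees V x y v w \<or> sees V y x v w)"
    using u unfolding urvg_iff by blast
  have fin: "finite V" and root: "r \<in> V" and br: "bridged E"
    using tree acyclic_imp_bridged[of V E] by (auto simp: rooted_tree_def simple_graph_def)
  have lev_r: "?lev r = 0" unfolding graph_dist_def by (rule Least_eq_0) simp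
  interpret h: tree_rep V E r par ?lev x y
    using par xy fin root br by unfold_locales auto
  interpret v: tree_rep V E r par ?lev y x
    using par xy fin root br apart_swap[of x y] by unfold_locales auto
  \<comment> \<open>The second class is the complement of the first, so the partition is immediate;
    its edges must be vertical because they are edges.\<close>
  define W where "W c = {w \<in> V - {r}. sees V x y w (par w) = c}" for c
  have vert: "sees V y x w (par w)" if "w \<in> W False" for w
  proof -
    have w: "w \<in> V - {r}" "\<not> sees V x y w (par w)" using that by (auto simp: W_def)
    have "w \<noteq> par w" using par[OF w(1)] by (metis n_not_Suc_n)
    then show ?thesis using w par[OF w(1)] xy[of w "par w"] by blast
  qed
  have desc: "card (desc par (W c) v d) \<le> 2 * d + 1" if "v \<in> V" for c v d
  proof (cases c)
    case True
    show ?thesis by (rule h.card_desc_le) (use True that in \<open>auto simp: W_def\<close>)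
  next
    case False
    show ?thesis by (rule v.card_desc_le) (use False that vert in \<open>auto simp: W_def\<close>)
  qed
  have W: "W True \<union> W False = V - {r}" "W True \<inter> W False = {}" by (auto simp: W_def)
  have level: "card {v \<in> V. ?lev v = n} \<le> top_count n" if "0 < n" for n
    unfolding card_tops[where lev = ?lev, OF W lev_r that, symmetric]
    by (rule card_tops_le[where par = par]) (use fin lev_r par W desc in auto)
  have "card E \<le> card (V - {r})" unfolding E using fin by (intro card_image_le) auto
  also have "\<dots> \<le> card (\<Union>n\<in>{1..depth V E r}. {v \<in> V. ?lev v = n})"
  proof (rule card_mono)
    show "V - {r} \<subseteq> (\<Union>n\<in>{1..depth V E r}. {v \<in> V. ?lev v = n})"
    proof
      fix v assume v: "v \<in> V - {r}"
      have "?lev v \<le> depth V E r" unfolding depth_def using fin v by (intro Max_ge) auto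
      then show "v \<in> (\<Union>n\<in>{1..depth V E r}. {v \<in> V. ?lev v = n})" using v par[OF v] by auto
    qed
  qed (use fin in auto)
  also have "\<dots> \<le> (\<Sum>n=1..depth V E r. card {v \<in> V. ?lev v = n})"
    by (rule card_UN_le) auto
  also have "\<dots> \<le> (\<Sum>n=1..depth V E r. top_count n)"
    by (intro sum_mono level) auto
  finally show ?thesis .
qed

section \<open>Solving the recursion for the level sizes\<close>

lemma sum_top_count_rec:
  "(\<Sum>n\<le>Suc (Suc n). int (top_count n)) = 5 * (\<Sum>n\<le>Suc n. int (top_count n)) - 2 * (\<Sum>n\<le>n. int (top_count n))"
proof -
  \<comment> \<open>Passing from \<open>Suc n\<close> to \<open>Suc (Suc n)\<close> raises every
    factor by 2 and adds one summand with factor 3. With \<open>S\<close> for the partial sums and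
    \<open>t\<close> for \<open>top_count\<close>, this reads
    \<open>t (n + 2) = 4 * t (n + 1) + 2 * S n\<close>.\<close>
  have "int (top_count (Suc (Suc n))) = (\<Sum>m<Suc (Suc n). int (top_count m) * (2 * int (Suc (Suc n) - m) + 1))"
    by (subst top_count.simps)
       (simp only: of_nat_sum of_nat_mult of_nat_add of_nat_1 of_nat_numeral nat.distinct if_False)
  also have "\<dots> = (\<Sum>m<Suc n. int (top_count m) * (2 * int (Suc (Suc n) - m) + 1)) + 3 * int (top_count (Suc n))"
    by simp
  also have "(\<Sum>m<Suc n. int (top_count m) * (2 * int (Suc (Suc n) - m) + 1))
      = (\<Sum>m<Suc n. int (top_count m) * (2 * int (Suc n - m) + 1) + 2 * int (top_count m))"
    by (intro sum.cong refl) (auto simp: Suc_diff_le algebra_simps)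
  also have "\<dots> = int (top_count (Suc n)) + 2 * (\<Sum>m<Suc n. int (top_count m))"
    by (subst (3) top_count.simps)
       (simp only: of_nat_sum of_nat_mult of_nat_add of_nat_1 of_nat_numeral nat.distinct if_False
         sum.distrib sum_distrib_left)
  finally show ?thesis by (simp add: lessThan_Suc_atMost)
qed

lemma sum_top_count:
  "(\<Sum>n=1..s. real (top_count n)) = - 2 + (1 - 3 / sqrt 17) * (1 / 2 * (5 - sqrt 17)) ^ s
                   + (1 + 3 / sqrt 17) * (1 / 2 * (5 + sqrt 17)) ^ s"
proof -
  have t: "top_count 0 = 2" "top_count (Suc 0) = 6"
    by (simp_all add: top_count.simps)
  define p q where "p = (5 - sqrt 17) / 2" and "q = (5 + sqrt 17) / 2"
  have s17: "sqrt 17 * sqrt 17 = (17::real)" by simp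
  have p2: "p * p = 5 * p - 2" and q2: "q * q = 5 * q - 2"
    unfolding p_def q_def using s17 by (simp_all add: field_simps)
  have rec: "(\<Sum>n\<le>Suc (Suc n). real (top_count n)) = 5 * (\<Sum>n\<le>Suc n. real (top_count n)) - 2 * (\<Sum>n\<le>n. real (top_count n))" for n
    using arg_cong[OF sum_top_count_rec[of n], of real_of_int]
    by (simp del: sum.atMost_Suc)
  have "(\<Sum>n\<le>s. real (top_count n)) = (1 - 3 / sqrt 17) * p ^ s + (1 + 3 / sqrt 17) * q ^ s"
  proof (induction s rule: induct_nat_012)
    case 0
    then show ?case by (simp add: t)
  next
    case 1
    then show ?case unfolding p_def q_def using s17 by (simp add: t field_simps)
  next
    case (ge2 n)
    have "p ^ Suc (Suc n) = 5 * p ^ Suc n - 2 * p ^ n" "q ^ Suc (Suc n) = 5 * q ^ Suc n - 2 * q ^ n"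
      using arg_cong[OF p2, of "\<lambda>z. z * p ^ n"] arg_cong[OF q2, of "\<lambda>z. z * q ^ n"]
      by (simp_all add: algebra_simps)
    then show ?case unfolding rec ge2 by (simp only:) (simp add: algebra_simps)
  qed
  \<comment> \<open>The term at 0 counts the root twice and no edge; it is the -2 of the
    formula.\<close>
  moreover have "(\<Sum>n\<le>s. real (top_count n)) = 2 + (\<Sum>n=1..s. real (top_count n))"
    unfolding atMost_atLeast0 by (subst sum.atLeast_Suc_atMost) (simp_all add: t)
  ultimately show ?thesis unfolding p_def q_def by simp
qed

section \<open>Trees given by a parent function\<close>

context
  fixes V :: "'a set" and r :: 'a and par :: "'a \<Rightarrow> 'a" and lev :: "'a \<Rightarrow> nat" and E :: "'a set set"
  assumes fin: "finite V" and root: "r \<in> V" "lev r = 0"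
    and par: "\<And>v. v \<in> V - {r} \<Longrightarrow> par v \<in> V \<and> lev v = Suc (lev (par v))"
  defines "E \<equiv> (\<lambda>v. {v, par v}) ` (V - {r})"
begin

lemma parent_edge_cases:
  assumes "{u, v} \<in> E"
  obtains "u \<in> V - {r}" "v = par u" "lev u = Suc (lev v)" | "v \<in> V - {r}" "u = par v" "lev v = Suc (lev u)"
proof -
  obtain w where w: "w \<in> V - {r}" "{u, v} = {w, par w}" using assms unfolding E_def by blast
  from w(2) consider "u = w" "v = par w" | "v = w" "u = par w" unfolding doubleton_eq_iff by blast
  then show thesis
  proof cases
    case 1
    show thesis by (rule that(1)) (use 1 w(1) par[OF w(1)] in simp_all)
  next
    case 2
    show thesis by (rule that(2)) (use 2 w(1) par[OF w(1)] in simp_all)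
  qed
qed

lemma par_neq: "v \<in> V - {r} \<Longrightarrow> par v \<noteq> v"
  using par[of v] by (metis n_not_Suc_n)

text \<open>Both neighbours of a deepest vertex of the cycle would be its parent, but they are
  distinct because the length is at least 3.\<close>

lemma parent_no_cycle: "\<not> graph_cycle E c"
proof
  assume c: "graph_cycle E c"
  define n where "n = length c"
  have n: "3 \<le> n" and dist: "distinct c" and edge: "\<And>i. i < n \<Longrightarrow> {c ! i, c ! (Suc i mod n)} \<in> E"
    using c by (auto simp: graph_cycle_def n_def)
  obtain i where i: "i < n" and max: "\<And>j. j < n \<Longrightarrow> lev (c ! j) \<le> lev (c ! i)"
  proof -
    have "Max ((\<lambda>j. lev (c ! j)) ` {..<n}) \<in> (\<lambda>j. lev (c ! j)) ` {..<n}"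
      using n by (intro Max_in) (auto simp: lessThan_empty_iff)
    then obtain i where i: "i < n" "Max ((\<lambda>j. lev (c ! j)) ` {..<n}) = lev (c ! i)" by auto
    moreover have "lev (c ! j) \<le> lev (c ! i)" if "j < n" for j
      unfolding i(2)[symmetric] using that by (intro Max_ge) auto
    ultimately show thesis using that by blast
  qed
  have nbr: "c ! j = par (c ! i)" if "j < n" "{c ! i, c ! j} \<in> E" for j
    using that(2) by (cases rule: parent_edge_cases) (use max[OF that(1)] in auto)
  define j where "j = (if i = 0 then n - 1 else i - 1)"
  have j: "j < n" "Suc j mod n = i" using i n by (auto simp: j_def)
  have k: "Suc i mod n < n" using n by simp
  have "Suc i mod n \<noteq> j"
    using i n by (cases "Suc i = n") (auto simp: j_def)
  moreover have "c ! (Suc i mod n) = par (c ! i)" using nbr k edge[OF i] by blast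
  moreover have "c ! j = par (c ! i)" using nbr j edge[OF j(1)] by (simp add: insert_commute)
  ultimately show False
    using nth_eq_iff_index_eq[OF dist, of "Suc i mod n" j] j(1) k unfolding n_def by metis
qed

lemma parent_simple_graph: "simple_graph V E"
  unfolding simple_graph_def
proof (intro conjI ballI)
  fix e assume "e \<in> E"
  then obtain v where v: "v \<in> V - {r}" "e = {v, par v}" unfolding E_def by blast
  then show "e \<subseteq> V" "card e = 2" using par[of v] par_neq[of v] by (auto simp: card_insert_if)
qed (rule fin)

lemma parent_rooted_tree: "rooted_tree V E r"
proof -
  have "(u, r) \<in> (adj E)\<^sup>*" if "u \<in> V" for u
    unfolding E_def by (rule parent_connected[where lev = lev]) (use par that in auto)
  then have "(u, v) \<in> (adj E)\<^sup>*" if "u \<in> V" "v \<in> V" for u v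
    using that by (meson adj_rtrancl_sym rtrancl_trans)
  then show ?thesis
    using parent_simple_graph parent_no_cycle root by (auto simp: rooted_tree_def graph_connected_def)
qed

lemma parent_graph_dist:
  assumes "v \<in> V"
  shows "graph_dist E r v = lev v"
  unfolding graph_dist_def
proof (rule Least_equality)
  show "(r, v) \<in> adj E ^^ lev v"
    using assms
  proof (induction "lev v" arbitrary: v)
    case 0
    then have "v = r" using par[of v] by (cases "v = r") auto
    then show ?case using root by simp
  next
    case (Suc n)
    then have v: "v \<in> V - {r}" using root by auto
    then have "(r, par v) \<in> adj E ^^ n"
      using Suc.hyps(1)[of "par v"] Suc.hyps(2) par[OF v] by auto
    moreover have "(par v, v) \<in> adj E" using v by (auto simp: E_def adj_def)
    ultimately show ?case using Suc.hyps(2)[symmetric] by auto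
  qed
  show "lev v \<le> m" if "(r, v) \<in> adj E ^^ m" for m
    using that
  proof (induction m arbitrary: v)
    case (Suc m)
    then obtain u where u: "(r, u) \<in> adj E ^^ m" "{u, v} \<in> E" by (auto simp: adj_def)
    show ?case using u(2) Suc.IH[OF u(1)] by (cases rule: parent_edge_cases) auto
  qed (use root in auto)
qed

lemma parent_card: "card E = card (V - {r})"
  unfolding E_def
proof (rule card_image, rule inj_onI)
  fix v w assume *: "v \<in> V - {r}" "w \<in> V - {r}" "{v, par v} = {w, par w}"
  show "v = w"
  proof (rule ccontr)
    assume "v \<noteq> w"
    then have "v = par w" "w = par v" using * by (auto simp: doubleton_eq_iff)
    then show False using par[OF *(1)] par[OF *(2)] by simp
  qed
qed

end

subsection \<open>An extremal tree\<close>

text \<open>In the extremal tree the vertices of a monochromatic component are indexed by pairs \<open>(i, k)\<close>: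
  the spine consists of the \<open>(i, 0)\<close>, and \<open>(i, 1), (i, 2), \<dots>\<close> is the leg attached to \<open>(i, 0)\<close>;
  the top is \<open>(0, 0)\<close>. A vertex is encoded by the path of components leading to it, the last one
  first, with the colour and position \<open>(c, i, k) \<noteq> (c, 0, 0)\<close> in each; the root is \<open>[]\<close>. The
  colour \<open>True\<close> is horizontal.\<close>

type_synonym node = "(bool \<times> int \<times> nat) list"

text \<open>\<open>free c v\<close> means that \<open>v\<close> is the top of its component of colour \<open>c\<close>.\<close>

fun free :: "bool \<Rightarrow> node \<Rightarrow> bool" where
  "free c [] = True"
| "free c ((c', i, k) # l) = (c \<noteq> c')"

fun valid :: "node \<Rightarrow> bool" where
  "valid [] = True"
| "valid ((c, i, k) # l) = ((i \<noteq> 0 \<or> k \<noteq> 0) \<and> free c l \<and> valid l)"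

fun weight :: "node \<Rightarrow> nat" where
  "weight [] = 0"
| "weight ((c, i, k) # l) = nat \<bar>i\<bar> + k + weight l"

text \<open>The top of the component of colour \<open>c\<close> that contains the vertex;
  \<open>tier\<close> and \<open>leg\<close> are the position in that component. A vertex that is
  itself the top gets the position (0, 0) by default.\<close>

fun host :: "bool \<Rightarrow> node \<Rightarrow> node" where
  "host c [] = []"
| "host c ((c', i, k) # l) = (if c = c' then l else (c', i, k) # l)"

fun tier :: "bool \<Rightarrow> node \<Rightarrow> int" where
  "tier c [] = 0"
| "tier c ((c', i, k) # l) = (if c = c' then i else 0)"

fun leg :: "bool \<Rightarrow> node \<Rightarrow> nat" where
  "leg c [] = 0"
| "leg c ((c', i, k) # l) = (if c = c' then k else 0)"

text \<open>Position (0, 0) is the top, which already has the code \<open>l\<close>; without this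
  case it would be encoded twice.\<close>

definition mk :: "bool \<Rightarrow> int \<Rightarrow> nat \<Rightarrow> node \<Rightarrow> node" where
  "mk c i k l = (if i = 0 \<and> k = 0 then l else (c, i, k) # l)"

fun parent :: "node \<Rightarrow> node" where
  "parent [] = []"
| "parent ((c, i, k) # l) = (if 0 < k then mk c i (k - 1) l else mk c (i - sgn i) 0 l)"

text \<open>An injective time stamp: in each component later positions on a leg, and all positions
  compared with the top, have larger stamps.\<close>

fun stamp :: "node \<Rightarrow> nat" where
  "stamp [] = 0"
| "stamp ((c, i, k) # l) = Suc (prod_encode (stamp l, prod_encode (to_nat (c, i), k)))"

text \<open>All squares of a horizontal component lie in one horizontal strip, at height \<open>i / 2\<close> above
  its middle, so that only consecutive tiers overlap. Every new square is placed outside everything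
  with a smaller stamp: odd tiers extend to the right and even tiers to the left, so that of two
  consecutive tiers only the two spine squares see each other. Vertical components are treated in
  the same way with the axes exchanged; \<open>K\<close> is the distance between different strips.\<close>

definition side :: "int \<Rightarrow> real" where
  "side i = (if odd i then 1 else - 1)"

fun base :: "real \<Rightarrow> node \<Rightarrow> real" where
  "base K [] = 0"
| "base K ((c, i, k) # l) = side i * (K * stamp ((c, i, k) # l))"

text \<open>The coordinate across the components of colour \<open>c\<close>: the ordinate for
  \<open>True\<close>, the abscissa for \<open>False\<close>. A vertex below the top in colour
  \<open>c\<close> is its own host in the other colour, so its coordinate along the component is its
  \<open>base\<close>.\<close>

definition coord :: "real \<Rightarrow> bool \<Rightarrow> node \<Rightarrow> real" where
  "coord K c v = base K (host c v) + tier c v / 2"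

lemma free_not: "v \<noteq> [] \<Longrightarrow> free (\<not> c) v \<longleftrightarrow> \<not> free c v"
  by (cases "(c, v)" rule: free.cases) auto

lemma mk_simps [simp]:
  assumes "free c l"
  shows "host c (mk c i k l) = l" "tier c (mk c i k l) = i" "leg c (mk c i k l) = k"
    "valid (mk c i k l) = valid l" "weight (mk c i k l) = nat \<bar>i\<bar> + k + weight l"
  using assms by (auto simp: mk_def; cases "(c, l)" rule: free.cases; simp)+

lemma mk_components:
  assumes "valid v"
  shows "mk c (tier c v) (leg c v) (host c v) = v" "free c (host c v)" "valid (host c v)"
  using assms by (cases "(c, v)" rule: free.cases; auto simp: mk_def)+

lemma component_inj:
  assumes "valid u" "valid v" "host c u = host c v" "tier c u = tier c v" "leg c u = leg c v"
  shows "u = v"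
proof -
  have "mk c (tier c u) (leg c u) (host c u) = mk c (tier c v) (leg c v) (host c v)"
    using assms(3-5) by simp
  then show ?thesis
    unfolding mk_components(1)[OF assms(1)] mk_components(1)[OF assms(2)] .
qed

lemma tier_le_weight: "nat \<bar>tier c v\<bar> \<le> weight v"
  by (cases "(c, v)" rule: free.cases) auto

lemma parent_props:
  assumes "valid v" "v \<noteq> []"
  shows "valid (parent v)" "weight v = Suc (weight (parent v))"
proof -
  obtain c i k l where v: "v = (c, i, k) # l" using assms by (cases v rule: parent.cases) auto
  then have "free c l" "valid l" "i \<noteq> 0 \<or> k \<noteq> 0" using assms by auto
  then show "valid (parent v)" "weight v = Suc (weight (parent v))"
    by (auto simp: v sgn_if)
qed

lemma prod_encode_strict_mono: "n < n' \<Longrightarrow> prod_encode (m, n) < prod_encode (m, n')"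
proof -
  have "triangle a < triangle (Suc a)" for a by simp
  then have "strict_mono triangle" by (simp add: strict_mono_Suc_iff)
  then show "n < n' \<Longrightarrow> prod_encode (m, n) < prod_encode (m, n')"
    by (simp add: prod_encode_def strict_mono_less)
qed

lemma stamp_tl: "stamp l < stamp ((c, i, k) # l)"
  using le_prod_encode_1[of "stamp l"] by (simp add: le_imp_less_Suc)

lemma stamp_leg: "k < k' \<Longrightarrow> stamp ((c, i, k) # l) < stamp ((c, i, k') # l)"
  by (simp add: prod_encode_strict_mono)

lemma stamp_eq_iff: "stamp u = stamp v \<longleftrightarrow> u = v"
proof (induction u arbitrary: v rule: stamp.induct)
  case 1
  show ?case by (cases v rule: stamp.cases) auto
next
  case (2 c i k l)
  then show ?case by (cases v rule: stamp.cases) (auto simp: prod_encode_eq)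
qed

lemma abs_base: "0 \<le> K \<Longrightarrow> \<bar>base K v\<bar> = K * stamp v"
  by (cases v rule: stamp.cases) (simp_all add: side_def abs_mult)

lemma base_gap:
  assumes "0 \<le> K" "u \<noteq> v"
  shows "K \<le> \<bar>base K u - base K v\<bar>"
proof -
  have "1 \<le> \<bar>real (stamp u) - real (stamp v)\<bar>"
    using assms(2) stamp_eq_iff[of u v] by linarith
  then have "K * 1 \<le> K * \<bar>real (stamp u) - real (stamp v)\<bar>"
    using assms(1) by (rule mult_left_mono)
  also have "\<dots> = \<bar>\<bar>base K u\<bar> - \<bar>base K v\<bar>\<bar>"
    using assms(1) by (simp add: abs_base flip: right_diff_distrib) (simp add: abs_mult)
  also have "\<dots> \<le> \<bar>base K u - base K v\<bar>" by (rule abs_triangle_ineq3)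
  finally show ?thesis by simp
qed

definition nodes :: "nat \<Rightarrow> node set" where
  "nodes s = {v. valid v \<and> weight v \<le> s}"

lemma tier_le: "v \<in> nodes s \<Longrightarrow> \<bar>real_of_int (tier c v)\<bar> \<le> real s"
proof -
  assume "v \<in> nodes s"
  then have "\<bar>tier c v\<bar> \<le> int s" using tier_le_weight[of c v] by (auto simp: nodes_def nat_le_iff)
  then show ?thesis by linarith
qed

lemma stamp_host_le: "stamp (host c v) \<le> stamp v"
  using stamp_tl by (cases "(c, v)" rule: free.cases) (auto intro: less_imp_le)

lemma side_cases: "side i = 1 \<and> odd i \<or> side i = - 1 \<and> even i"
  by (auto simp: side_def)

section \<open>Which squares of the layout see each other\<close>

definition joined :: "bool \<Rightarrow> node \<Rightarrow> node \<Rightarrow> bool" where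
  "joined c u v \<longleftrightarrow> host c u = host c v \<and>
     (tier c u = tier c v \<and> (leg c v = Suc (leg c u) \<or> leg c u = Suc (leg c v)) \<or>
      leg c u = 0 \<and> leg c v = 0 \<and> \<bar>tier c u - tier c v\<bar> = 1)"

lemma joined_cases:
  assumes "joined c u v"
  obtains "host c u = host c v" "tier c u = tier c v" "leg c v = Suc (leg c u)"
    | "host c u = host c v" "tier c u = tier c v" "leg c u = Suc (leg c v)"
    | "host c u = host c v" "leg c u = 0" "leg c v = 0" "tier c v = tier c u + 1"
    | "host c u = host c v" "leg c u = 0" "leg c v = 0" "tier c u = tier c v + 1"
proof -
  have "tier c v = tier c u + 1 \<or> tier c u = tier c v + 1" if "\<bar>tier c u - tier c v\<bar> = 1"
    using that by linarith
  then show thesis using assms that unfolding joined_def by blast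
qed

lemma blocked:
  assumes "w \<in> V" "w \<noteq> u" "w \<noteq> v" "y w = y u"
    and "min (x u) (x v) < x w" "x w < max (x u) (x v)"
  shows "\<not> sees V x y u v"
proof
  assume "sees V x y u v"
  then obtain a b where ab: "a < b" "y u \<le> a" "b \<le> y u + 1"
    and bl: "\<forall>w\<in>V - {u, v}. min (x u) (x v) < x w \<and> x w < max (x u) (x v) \<longrightarrow> y w + 1 \<le> a \<or> b \<le> y w"
    unfolding sees_def by blast
  have "y w + 1 \<le> a \<or> b \<le> y w" using bl assms by blast
  then show False using ab assms(4) by auto
qed

context
  fixes s :: nat and K :: real
  assumes K: "K = real s + 1"
begin

text \<open>This explains \<open>K = s + 1\<close>: tiers are at most \<open>s\<close> in absolute
  value, so the shifts by half a tier use up at most \<open>s\<close> of the distance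
  \<open>K\<close>.\<close>

lemma coord_gap:
  assumes "u \<in> nodes s" "v \<in> nodes s" "host c u \<noteq> host c v"
  shows "1 \<le> \<bar>coord K c u - coord K c v\<bar>"
proof -
  have "K \<le> \<bar>base K (host c u) - base K (host c v)\<bar>"
    using base_gap assms(3) K by simp
  then show ?thesis
    using tier_le[OF assms(1), of c] tier_le[OF assms(2), of c] K unfolding coord_def by linarith
qed

lemma coord_bound: "v \<in> nodes s \<Longrightarrow> \<bar>coord K c v\<bar> \<le> K * stamp v + s / 2"
proof -
  assume v: "v \<in> nodes s"
  have "\<bar>base K (host c v)\<bar> \<le> K * stamp v"
    using stamp_host_le[of c v] K by (simp add: abs_base)
  then show ?thesis
    using tier_le[OF v, of c] unfolding coord_def by linarith
qed

lemma coord_outer: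
  assumes "\<not> free c u"
  shows "coord K (\<not> c) u = side (tier c u) * (K * stamp u)"
  using assms by (cases "(c, u)" rule: free.cases) (auto simp: coord_def)

text \<open>The position of the top along this component is set by its component of the other colour
  and may carry a tier shift of up to \<open>s / 2\<close>. The larger stamp of \<open>u\<close>
  gains \<open>K\<close>, enough for the shift and for one square.\<close>

lemma coord_host_lt:
  assumes "u \<in> nodes s" "v \<in> nodes s" "host c u = v" "\<not> free c u"
  shows "\<bar>coord K (\<not> c) v\<bar> + 1 \<le> K * stamp u"
proof -
  have "Suc (stamp v) \<le> stamp u"
    using assms stamp_tl by (cases "(c, u)" rule: free.cases) (auto simp: Suc_le_eq)
  then have "K * (stamp v + 1) \<le> K * stamp u"
    using K by (intro mult_left_mono) auto
  then show ?thesis using coord_bound[OF assms(2), of "\<not> c"] K by (simp add: algebra_simps)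
qed

lemma free_components: "free c v \<Longrightarrow> host c v = v \<and> tier c v = 0 \<and> leg c v = 0"
  by (cases "(c, v)" rule: free.cases) auto

lemma leg_order:
  assumes u: "u \<in> nodes s" and v: "v \<in> nodes s"
    and "host c u = host c v" "tier c u = tier c v" "leg c u < leg c v"
  shows "1 \<le> side (tier c v) * (coord K (\<not> c) v - coord K (\<not> c) u)"
proof -
  have fv: "\<not> free c v" using assms(5) free_components[of c v] by auto
  show ?thesis
  proof (cases "free c u")
    case True
    then have "tier c v = 0" "host c v = u" using assms free_components[of c u] by auto
    then show ?thesis
      using coord_host_lt[OF v u _ fv] coord_outer[OF fv] by (simp add: side_def)
  next
    case False
    have "stamp u < stamp v"
      using False fv assms stamp_leg by (cases "(c, u)" rule: free.cases; cases "(c, v)" rule: free.cases) auto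
    then have "Suc (stamp u) \<le> stamp v" by simp
    then have "K * (stamp u + 1) \<le> K * stamp v"
      using K by (intro mult_left_mono) auto
    then show ?thesis
      unfolding coord_outer[OF fv] coord_outer[OF False] assms(4)
      using side_cases[of "tier c v"] K by (auto simp: algebra_simps)
  qed
qed

text \<open>Below the top, odd tiers have positive and even tiers nonpositive coordinates. Only the
  top can lie anywhere, and it is closer to the origin than \<open>u\<close>.\<close>

lemma tier_order_odd:
  assumes u: "u \<in> nodes s" and v: "v \<in> nodes s"
    and "host c u = host c v" "odd (tier c u)" "even (tier c v)"
  shows "1 \<le> coord K (\<not> c) u - coord K (\<not> c) v"
proof -
  have fu: "\<not> free c u" using assms(4) free_components[of c u] by auto
  have cu: "coord K (\<not> c) u = K * stamp u"
    using coord_outer[OF fu] assms(4) by (simp add: side_def)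
  show ?thesis
  proof (cases "free c v")
    case True
    then have "host c u = v" using assms free_components[of c v] by auto
    then show ?thesis using coord_host_lt[OF u v _ fu] cu by linarith
  next
    case False
    have "stamp u \<noteq> 0" using fu stamp_eq_iff[of u "[]"] by auto
    then have "K * 1 \<le> K * stamp u" using K by (intro mult_left_mono) auto
    moreover have "coord K (\<not> c) v = - (K * stamp v)"
      using coord_outer[OF False] assms(5) by (simp add: side_def)
    moreover have "0 \<le> K * stamp v" using K by simp
    ultimately show ?thesis using cu K by linarith
  qed
qed

lemma tier_order:
  assumes "u \<in> nodes s" "v \<in> nodes s" "host c u = host c v" "even (tier c u) \<noteq> even (tier c v)"
  shows "1 \<le> side (tier c u) * (coord K (\<not> c) u - coord K (\<not> c) v)"
  using tier_order_odd[OF assms(1,2,3)] tier_order_odd[OF assms(2,1) assms(3)[symmetric]] assms(4)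
  by (auto simp: side_def)

lemma same_host_coord:
  assumes "host c u = host c v"
  shows "coord K c u - coord K c v = real_of_int (tier c u - tier c v) / 2"
  using assms by (simp add: coord_def diff_divide_distrib)

lemma close_imp:
  assumes "u \<in> nodes s" "v \<in> nodes s" "\<bar>coord K c u - coord K c v\<bar> < 1"
  shows "host c u = host c v \<and> \<bar>tier c u - tier c v\<bar> \<le> 1"
proof -
  have h: "host c u = host c v" using coord_gap[OF assms(1,2), of c] assms(3) by fastforce
  have "\<bar>real_of_int (tier c u - tier c v) / 2\<bar> < 1"
    using assms(3) unfolding same_host_coord[OF h] .
  then have "\<bar>real_of_int (tier c u - tier c v)\<bar> < 2" by (simp only: abs_divide) simp
  then show ?thesis using h by linarith
qed

lemma nodes_apart:
  assumes "u \<in> nodes s" "v \<in> nodes s" "u \<noteq> v"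
  shows "apart (coord K (\<not> c)) (coord K c) u v"
proof (rule ccontr)
  assume *: "\<not> ?thesis"
  then have h: "host c u = host c v" "\<bar>tier c u - tier c v\<bar> \<le> 1"
    using close_imp[OF assms(1,2), of c] by (auto simp: apart_def)
  have n: "\<bar>coord K (\<not> c) u - coord K (\<not> c) v\<bar> < 1" using * by (simp add: apart_def)
  show False
  proof (cases "tier c u = tier c v")
    case True
    then have "leg c u \<noteq> leg c v" using component_inj[of u v c] assms h by (auto simp: nodes_def)
    then have "leg c u < leg c v \<or> leg c v < leg c u" by linarith
    then show False
      using leg_order[OF assms(1,2) h(1) True] leg_order[OF assms(2,1) h(1)[symmetric] True[symmetric]]
        n side_cases[of "tier c v"] True by auto
  next
    case False
    then have "\<bar>tier c u - tier c v\<bar> = 1" using h(2) by linarith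
    then have "even (tier c u) \<noteq> even (tier c v)" by presburger
    then show False using tier_order[OF assms(1,2) h(1)] n side_cases[of "tier c u"] by auto
  qed
qed

text \<open>Other squares of the same tier come before or after both squares on the leg, and those
  of neighbouring tiers lie on the far side of both, so the gap is empty.\<close>

lemma sees_leg:
  assumes u: "u \<in> nodes s" and v: "v \<in> nodes s"
    and h: "host c u = host c v" "tier c u = tier c v" "leg c v = Suc (leg c u)"
  shows "sees (nodes s) (coord K (\<not> c)) (coord K c) u v"
  unfolding sees_def
proof (rule exI[of _ "coord K c u"], rule exI[of _ "coord K c u + 1"], intro conjI ballI impI)
  have e: "coord K c u = coord K c v" using same_host_coord[OF h(1)] h(2) by simp
  then show "coord K c v \<le> coord K c u" "coord K c u + 1 \<le> coord K c v + 1" by auto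
  fix w assume w: "w \<in> nodes s - {u, v}"
    and mid: "min (coord K (\<not> c) u) (coord K (\<not> c) v) < coord K (\<not> c) w \<and>
              coord K (\<not> c) w < max (coord K (\<not> c) u) (coord K (\<not> c) v)"
  have w': "w \<in> nodes s" using w by auto
  show "coord K c w + 1 \<le> coord K c u \<or> coord K c u + 1 \<le> coord K c w"
  proof (rule ccontr)
    assume "\<not> ?thesis"
    then have hw: "host c w = host c u" "\<bar>tier c w - tier c u\<bar> \<le> 1"
      using close_imp[OF w' u, of c] by auto
    note sc = side_cases[of "tier c u"] side_cases[of "tier c w"]
    show False
    proof (cases "tier c w = tier c u")
      case True
      have "leg c w \<noteq> leg c u" "leg c w \<noteq> leg c v"
        using component_inj[of w u c] component_inj[of w v c] w u v h hw True by (auto simp: nodes_def)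
      then consider "leg c w < leg c u" | "leg c v < leg c w" using h(3) by linarith
      then show False
      proof cases
        case 1
        then show False
          using leg_order[OF w' u hw(1) True] leg_order[OF u v h(1,2)] h(2,3) mid sc(1) by auto
      next
        case 2
        then show False
          using leg_order[OF v w', of c] leg_order[OF u v h(1,2)] h hw True mid sc(1) by auto
      qed
    next
      case False
      then have "\<bar>tier c w - tier c u\<bar> = 1" using hw(2) by linarith
      then have "even (tier c w) \<noteq> even (tier c u)" by presburger
      then show False
        using tier_order[OF w' u hw(1)] tier_order[OF w' v, of c] h hw mid sc(2) by auto
    qed
  qed
qed auto

lemma sees_tier:
  assumes u: "u \<in> nodes s" and v: "v \<in> nodes s"
    and h: "host c u = host c v" "leg c u = 0" "leg c v = 0" "tier c v = tier c u + 1"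
  shows "sees (nodes s) (coord K (\<not> c)) (coord K c) u v"
  unfolding sees_def
\<comment> \<open>The band is the overlap of the two tiers, of height 1/2. The next tier below ends
  exactly at its lower edge and the next tier above begins at its upper edge, so only legs of these
  two tiers could block, and they run outward in opposite directions.\<close>
proof (rule exI[of _ "coord K c v"], rule exI[of _ "coord K c u + 1"], intro conjI ballI impI)
  have e: "coord K c v = coord K c u + 1/2" using same_host_coord[OF h(1)] h(4) by simp
  then show "coord K c v < coord K c u + 1" "coord K c u \<le> coord K c v" "coord K c u + 1 \<le> coord K c v + 1"
    by auto
  fix w assume w: "w \<in> nodes s - {u, v}"
    and mid: "min (coord K (\<not> c) u) (coord K (\<not> c) v) < coord K (\<not> c) w \<and>
              coord K (\<not> c) w < max (coord K (\<not> c) u) (coord K (\<not> c) v)"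
  have w': "w \<in> nodes s" using w by auto
  show "coord K c w + 1 \<le> coord K c v \<or> coord K c u + 1 \<le> coord K c w"
  proof (rule ccontr)
    assume *: "\<not> ?thesis"
    then have hw: "host c w = host c u" "host c w = host c v"
      and "\<bar>tier c w - tier c u\<bar> \<le> 1" "\<bar>tier c w - tier c v\<bar> \<le> 1"
      using close_imp[OF w' u, of c] close_imp[OF w' v, of c] e by auto
    then have wuv: "tier c w = tier c u \<or> tier c w = tier c v" using h(4) by linarith
    have parity: "even (tier c u) \<noteq> even (tier c v)" using h(4) by simp
    note uv = tier_order[OF u v h(1) parity] tier_order[OF v u h(1)[symmetric] parity[symmetric]]
    note sc = side_cases[of "tier c u"] side_cases[of "tier c v"]
    show False using wuv
    proof
      assume r: "tier c w = tier c u"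
      then have "0 < leg c w" using component_inj[of w u c] w u h hw by (auto simp: nodes_def)
      then show False using leg_order[OF u w', of c] r hw h uv mid sc(1) by auto
    next
      assume r: "tier c w = tier c v"
      then have "0 < leg c w" using component_inj[of w v c] w v h hw by (auto simp: nodes_def)
      then show False using leg_order[OF v w', of c] r hw h uv mid sc(2) by auto
    qed
  qed
qed auto

text \<open>Supplies blocking squares: moving down a leg lowers the weight, so the cut-off at
  \<open>s\<close> keeps all inner positions.\<close>

lemma inner_leg:
  assumes u: "u \<in> nodes s" and k: "k \<le> leg c u"
  obtains w where "w \<in> nodes s" "host c w = host c u" "tier c w = tier c u" "leg c w = k"
    "coord K c w = coord K c u"
proof -
  have val: "valid u" using u by (simp add: nodes_def)
  let ?w = "mk c (tier c u) k (host c u)"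
  note mk = mk_components[OF val, of c]
  have "weight u = nat \<bar>tier c u\<bar> + leg c u + weight (host c u)"
    using mk_simps(5)[OF mk(2), of "tier c u" "leg c u"] mk(1) by simp
  then have "?w \<in> nodes s" using u k mk by (simp add: nodes_def)
  then show thesis using that[of ?w] mk by (simp add: coord_def)
qed

lemma sees_imp_leg_le:
  assumes u: "u \<in> nodes s" and v: "v \<in> nodes s"
    and sees: "sees (nodes s) (coord K (\<not> c)) (coord K c) u v"
    and h: "host c u = host c v" "tier c u = tier c v"
  shows "leg c v \<le> Suc (leg c u)"
proof (rule ccontr)
  assume n: "\<not> ?thesis"
  obtain w where w: "w \<in> nodes s" "host c w = host c v" "tier c w = tier c v" "leg c w = Suc (leg c u)"
    using inner_leg[OF v, of "Suc (leg c u)" c] n by auto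
  have "coord K c w = coord K c u" using w h by (simp add: coord_def)
  moreover have "1 \<le> side (tier c v) * (coord K (\<not> c) w - coord K (\<not> c) u)"
    "1 \<le> side (tier c v) * (coord K (\<not> c) v - coord K (\<not> c) w)"
    using leg_order[OF u w(1), of c] leg_order[OF w(1) v, of c] w h n by auto
  moreover have "w \<noteq> u" "w \<noteq> v" using w n by auto
  ultimately show False
    using blocked[of w "nodes s" u v "coord K c" "coord K (\<not> c)"] sees w n side_cases[of "tier c v"] by auto
qed

text \<open>The spine square of the same tier has the height of \<open>u\<close> and lies between
  \<open>u\<close> and the whole neighbouring tier, so it hides a leg square.\<close>

lemma sees_imp_leg_zero:
  assumes u: "u \<in> nodes s" and v: "v \<in> nodes s"
    and sees: "sees (nodes s) (coord K (\<not> c)) (coord K c) u v"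
    and h: "host c u = host c v" "\<bar>tier c u - tier c v\<bar> = 1"
  shows "leg c u = 0"
proof (rule ccontr)
  assume n: "leg c u \<noteq> 0"
  obtain w where w: "w \<in> nodes s" "host c w = host c u" "tier c w = tier c u" "leg c w = 0"
    "coord K c w = coord K c u"
    using inner_leg[OF u, of 0 c] by auto
  have "even (tier c w) \<noteq> even (tier c v)" using h(2) w(3) by presburger
  then have "1 \<le> side (tier c u) * (coord K (\<not> c) w - coord K (\<not> c) v)"
    "1 \<le> side (tier c u) * (coord K (\<not> c) u - coord K (\<not> c) w)"
    using leg_order[OF w(1) u, of c] tier_order[OF w(1) v, of c] w h n by auto
  moreover have "w \<noteq> u" "w \<noteq> v" using w h n by auto
  ultimately show False
    using blocked[of w "nodes s" u v "coord K c" "coord K (\<not> c)"] sees w side_cases[of "tier c u"] by auto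
qed

lemma sees_iff_joined:
  assumes u: "u \<in> nodes s" and v: "v \<in> nodes s" and "u \<noteq> v"
  shows "sees (nodes s) (coord K (\<not> c)) (coord K c) u v \<longleftrightarrow> joined c u v"
proof
  assume sees: "sees (nodes s) (coord K (\<not> c)) (coord K c) u v"
  then have sees': "sees (nodes s) (coord K (\<not> c)) (coord K c) v u" by (simp add: sees_commute)
  have h: "host c u = host c v" "\<bar>tier c u - tier c v\<bar> \<le> 1"
    using close_imp[OF u v] sees_imp_close[OF sees] by auto
  show "joined c u v"
  proof (cases "tier c u = tier c v")
    case True
    then have "leg c u \<noteq> leg c v" using component_inj[of u v c] assms h by (auto simp: nodes_def)
    then show ?thesis
      using sees_imp_leg_le[OF u v sees] sees_imp_leg_le[OF v u sees'] h True by (auto simp: joined_def)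
  next
    case False
    then have "\<bar>tier c u - tier c v\<bar> = 1" "\<bar>tier c v - tier c u\<bar> = 1" using h by linarith+
    then show ?thesis
      using sees_imp_leg_zero[OF u v sees] sees_imp_leg_zero[OF v u sees'] h by (auto simp: joined_def)
  qed
next
  assume "joined c u v"
  then show "sees (nodes s) (coord K (\<not> c)) (coord K c) u v"
    by (cases rule: joined_cases) (use u v sees_leg sees_tier sees_commute in metis)+
qed

end

lemma joined_imp_parent:
  assumes val: "valid u" "valid v" and j: "joined c u v"
  shows "u \<noteq> [] \<and> parent u = v \<or> v \<noteq> [] \<and> parent v = u"
proof -
  have up: "b \<noteq> [] \<and> parent b = a"
    if "valid a" "valid b" "host c a = host c b" "tier c a = tier c b" "leg c b = Suc (leg c a)" for a b
  proof -
    have "a = mk c (tier c a) (leg c a) (host c a)" "b = mk c (tier c a) (Suc (leg c a)) (host c a)"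
      using mk_components(1)[of a c] mk_components(1)[of b c] that by simp_all
    then show ?thesis by (metis mk_def nat.distinct(1) list.distinct(1) parent.simps(2) zero_less_Suc diff_Suc_1)
  qed
  have side: "a \<noteq> [] \<and> parent a = b \<or> b \<noteq> [] \<and> parent b = a"
    if "valid a" "valid b" "host c a = host c b" "tier c b = tier c a + 1" "leg c a = 0" "leg c b = 0" for a b
  proof -
    have ab: "a = mk c (tier c a) 0 (host c a)" "b = mk c (tier c a + 1) 0 (host c a)"
      using mk_components(1)[of a c] mk_components(1)[of b c] that by simp_all
    \<comment> \<open>Of two consecutive spine vertices the one nearer to tier 0 is the parent,
      hence the split by sign.\<close>
    show ?thesis
    proof (cases "0 \<le> tier c a")
      case True
      then have "b = (c, tier c a + 1, 0) # host c a" using ab(2) by (simp add: mk_def)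
      then show ?thesis using True ab(1) by (simp add: sgn_if)
    next
      case False
      then have "a = (c, tier c a, 0) # host c a" using ab(1) by (simp add: mk_def)
      then have "a \<noteq> []" "parent a = mk c (tier c a + 1) 0 (host c a)"
        using False by (metis list.distinct(1), metis parent.simps(2) less_irrefl sgn_if diff_minus_eq_add not_le less_le)
      then show ?thesis using ab(2) by simp
    qed
  qed
  show ?thesis
    using j by (cases rule: joined_cases) (use up[of u v] up[of v u] side[of u v] side[of v u] val in auto)
qed

lemma parent_joined:
  assumes "valid v" "v \<noteq> []"
  shows "\<exists>c. joined c v (parent v)"
proof -
  obtain c i k l where v: "v = (c, i, k) # l" using assms by (cases v rule: parent.cases) auto
  then have "free c l" "i \<noteq> 0 \<or> k \<noteq> 0" using assms by auto
  then have "joined c v (parent v)" by (auto simp: joined_def v sgn_if)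
  then show ?thesis ..
qed

lemma joined_sym: "joined c u v \<longleftrightarrow> joined c v u"
proof -
  have "joined c b a" if "joined c a b" for a b
    using that by (cases rule: joined_cases) (simp_all add: joined_def)
  then show ?thesis by blast
qed

lemma joined_iff:
  assumes "valid u" "valid v"
  shows "(\<exists>c. joined c u v) \<longleftrightarrow> u \<noteq> [] \<and> parent u = v \<or> v \<noteq> [] \<and> parent v = u"
  using joined_imp_parent[OF assms] parent_joined assms joined_sym by metis

section \<open>Level sizes of the extremal tree\<close>

definition level :: "nat \<Rightarrow> node set" where
  "level n = {v. valid v \<and> weight v = n}"

definition level_tops :: "nat \<Rightarrow> (bool \<times> node) set" where
  "level_tops n = {(c, v). v \<in> level n \<and> free c v}"

text \<open>Each \<open>i\<close> from \<open>- d\<close> to \<open>d\<close> leaves exactly one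
  \<open>k\<close>; this attains the bound \<open>2 * d + 1\<close> on a monochromatic
  component.\<close>

lemma card_offsets:
  "finite {(i, k). nat \<bar>i\<bar> + k = d}" "card {(i, k). nat \<bar>i\<bar> + k = d} = 2 * d + 1"
proof -
  have "bij_betw (\<lambda>i. (i, d - nat \<bar>i\<bar>)) {- int d..int d} {(i, k). nat \<bar>i\<bar> + k = d}"
    by (rule bij_betwI[where g = fst]) auto
  then show "finite {(i, k). nat \<bar>i\<bar> + k = d}" "card {(i, k). nat \<bar>i\<bar> + k = d} = 2 * d + 1"
    using bij_betw_finite bij_betw_same_card by fastforce+
qed

lemma weight_eq_0: "valid v \<Longrightarrow> weight v = 0 \<Longrightarrow> v = []"
  by (cases v rule: weight.cases) auto

lemma level_0: "level 0 = {[]}"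
  using weight_eq_0 by (auto simp: level_def)

lemma card_level_tops_eq:
  assumes "0 < n"
  shows "finite (level_tops n) \<longleftrightarrow> finite (level n)" "card (level_tops n) = card (level n)"
proof -
  have "bij_betw snd (level_tops n) (level n)"
  proof (rule bij_betwI')
    fix p q assume pq: "p \<in> level_tops n" "q \<in> level_tops n"
    obtain c v d w where cvdw: "p = (c, v)" "q = (d, w)" by (cases p, cases q)
    have "c = d" if "v = w"
    proof (rule ccontr)
      assume "c \<noteq> d"
      then have "d = (\<not> c)" by blast
      moreover have "v \<noteq> []" "free c v" "free d v"
        using pq assms that unfolding cvdw level_tops_def level_def by force+
      ultimately show False using free_not by blast
    qed
    then show "snd p = snd q \<longleftrightarrow> p = q" using cvdw by auto
  next
    fix v assume v: "v \<in> level n"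
    then have "v \<noteq> []" using assms by (auto simp: level_def)
    then have "free True v \<or> free False v" using free_not[of v True] by auto
    then show "\<exists>p\<in>level_tops n. v = snd p" using v by (force simp: level_tops_def)
  qed (auto simp: level_tops_def)
  then show "finite (level_tops n) \<longleftrightarrow> finite (level n)" "card (level_tops n) = card (level n)"
    using bij_betw_finite bij_betw_same_card by auto
qed

text \<open>A vertex is given by the top of the component of its parent edge and its position there.
  Positions at distance \<open>n - m > 0\<close> exclude (0, 0), so every combination is
  valid.\<close>

lemma level_bij:
  assumes "0 < n"
  shows "bij_betw (\<lambda>(m, (c, l), i, k). (c, i, k) # l)
    (SIGMA m:{..<n}. level_tops m \<times> {(i, k). nat \<bar>i\<bar> + k = n - m}) (level n)"
proof (rule bij_betw_imageI)
  show "inj_on (\<lambda>(m, (c, l), i, k). (c, i, k) # l)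
      (SIGMA m:{..<n}. level_tops m \<times> {(i, k). nat \<bar>i\<bar> + k = n - m})"
    by (auto simp: inj_on_def level_tops_def level_def)
  have "v \<in> (\<lambda>(m, (c, l), i, k). (c, i, k) # l) `
      (SIGMA m:{..<n}. level_tops m \<times> {(i, k). nat \<bar>i\<bar> + k = n - m})" if lv: "v \<in> level n" for v
  proof -
    obtain c i k l where v: "v = (c, i, k) # l"
      using lv assms by (cases v rule: weight.cases) (auto simp: level_def)
    then show ?thesis
      using lv by (intro image_eqI[of _ _ "(weight l, (c, l), i, k)"]) (auto simp: level_def level_tops_def)
  qed
  then show "(\<lambda>(m, (c, l), i, k). (c, i, k) # l) `
      (SIGMA m:{..<n}. level_tops m \<times> {(i, k). nat \<bar>i\<bar> + k = n - m}) = level n"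
    by (auto simp: level_def level_tops_def)
qed

lemma card_level_tops: "finite (level_tops n) \<and> card (level_tops n) = top_count n"
proof (induction n rule: less_induct)
  case (less n)
  show ?case
  proof (cases "n = 0")
    case True
    have "level_tops 0 = {(True, []), (False, [])}"
      by (auto simp: level_tops_def level_0)
    then show ?thesis using True by (simp add: top_count.simps)
  next
    case False
    let ?S = "SIGMA m:{..<n}. level_tops m \<times> {(i, k). nat \<bar>i\<bar> + k = n - m}"
    have bij: "bij_betw (\<lambda>(m, (c, l), i, k). (c, i, k) # l) ?S (level n)"
      using level_bij False by simp
    have "finite ?S" using less card_offsets by (intro finite_SigmaI finite_cartesian_product) auto
    moreover have "card ?S = (\<Sum>m<n. top_count m * (2 * (n - m) + 1))"
      using less card_offsets by (subst card_SigmaI) (auto simp: card_cartesian_product)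
    ultimately show ?thesis
      using bij_betw_finite[OF bij] bij_betw_same_card[OF bij] card_level_tops_eq[of n] False
      by (simp add: top_count.simps)
  qed
qed

lemma card_nodes: "finite (nodes s)" "card (nodes s - {[]}) = (\<Sum>n=1..s. top_count n)"
proof -
  have fin: "finite (level n)" for n
    using card_level_tops[of n] card_level_tops_eq[of n] by (cases "n = 0") (auto simp: level_0)
  have "nodes s = (\<Union>n\<le>s. level n)" by (auto simp: nodes_def level_def)
  then show "finite (nodes s)" using fin by simp
  have "nodes s - {[]} = (\<Union>n\<in>{1..s}. level n)"
    using weight_eq_0 by (fastforce simp: nodes_def level_def Suc_le_eq)
  moreover have "card (\<Union>n\<in>{1..s}. level n) = (\<Sum>n=1..s. card (level n))"
    using fin by (intro card_UN_disjoint) (auto simp: level_def)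
  moreover have "card (level n) = top_count n" if "n \<in> {1..s}" for n
    using that card_level_tops[of n] card_level_tops_eq[of n] by simp
  ultimately show "card (nodes s - {[]}) = (\<Sum>n=1..s. top_count n)" by simp
qed

lemma sees_image:
  assumes "inj_on f V" "v \<in> V" "w \<in> V" "\<And>u. u \<in> V \<Longrightarrow> g (f u) = u"
  shows "sees (f ` V) (x \<circ> g) (y \<circ> g) (f v) (f w) \<longleftrightarrow> sees V x y v w"
proof -
  have "f ` V - {f v, f w} = f ` (V - {v, w})"
    using assms by (auto simp: inj_on_def)
  then show ?thesis unfolding sees_def using assms by simp
qed

lemma extremal_tree:
  assumes "1 \<le> s"
  shows "\<exists>(V :: nat set) E r. rooted_tree V E r \<and> depth V E r = s \<and> urvg V E \<and>
    card E = (\<Sum>n=1..s. top_count n)"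
proof -
  \<comment> \<open>The injective \<open>stamp\<close> also serves to turn vertices into natural
    numbers, with the root at 0.\<close>
  define g where "g = inv stamp"
  define V where "V = stamp ` nodes s"
  define par where "par = stamp \<circ> parent \<circ> g"
  define lev where "lev = weight \<circ> g"
  define E where "E = (\<lambda>v. {v, par v}) ` (V - {0})"
  define K where "K = real s + 1"
  have inj: "inj stamp" using stamp_eq_iff by (auto simp: inj_def)
  then have g [simp]: "g (stamp v) = v" for v by (simp add: g_def)
  have stamp0 [simp]: "stamp v = 0 \<longleftrightarrow> v = []" for v using stamp_eq_iff[of v "[]"] by simp
  have stamp_pos [simp]: "0 < stamp v \<longleftrightarrow> v \<noteq> []" for v using stamp0[of v] by linarith
  have gz: "g 0 = []" using g[of "[]"] by simp
  have V: "finite V" "0 \<in> V"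
    using card_nodes(1) image_eqI[of 0 stamp "[]" "nodes s"] by (auto simp: V_def nodes_def)
  have lev0: "lev 0 = 0" by (simp add: lev_def gz)
  have par: "par v \<in> V \<and> lev v = Suc (lev (par v))" if v: "v \<in> V - {0}" for v
  proof -
    obtain u where u: "v = stamp u" "u \<in> nodes s" "u \<noteq> []" using v by (auto simp: V_def)
    then show ?thesis
      using parent_props[of u] by (auto simp: V_def par_def lev_def nodes_def)
  qed
  note tree = V lev0 par
  have rt: "rooted_tree V E 0"
    unfolding E_def by (rule parent_rooted_tree[where lev = lev]) (use tree in auto)
  have dist: "graph_dist E 0 v = lev v" if "v \<in> V" for v
    unfolding E_def by (rule parent_graph_dist[where lev = lev]) (use tree that in auto)
  have cardE: "card E = card (V - {0})"
    unfolding E_def by (rule parent_card[where lev = lev]) (use tree in auto)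
  have V0: "V - {0} = stamp ` (nodes s - {[]})" by (auto simp: V_def)
  have E: "E = (\<lambda>a. {stamp a, stamp (parent a)}) ` (nodes s - {[]})"
    unfolding E_def V0 image_image par_def by simp
  from V0 have "card E = card (nodes s - {[]})"
    using cardE inj by (simp add: card_image inj_on_subset)
  then have "card E = (\<Sum>n=1..s. top_count n)" by (simp add: card_nodes)
  moreover have "depth V E 0 = s"
    unfolding depth_def
  proof (rule Max_eqI)
    show "n \<le> s" if "n \<in> graph_dist E 0 ` V" for n
      using that dist by (auto simp: V_def lev_def nodes_def)
    \<comment> \<open>The end of the leg at the root has level \<open>s\<close>; it is a valid code
      because \<open>s\<close> is positive.\<close>
    have "[(True, 0, s)] \<in> nodes s" using assms by (simp add: nodes_def)
    then have "stamp [(True, 0, s)] \<in> V" by (auto simp: V_def simp del: stamp.simps)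
    moreover have "lev (stamp [(True, 0, s)]) = s" unfolding lev_def comp_def g by simp
    ultimately show "s \<in> graph_dist E 0 ` V" using dist by (metis image_eqI)
  qed (use V in auto)
  moreover have "apart (coord K False \<circ> g) (coord K True \<circ> g) v w \<and>
      ({v, w} \<in> E \<longleftrightarrow> sees V (coord K False \<circ> g) (coord K True \<circ> g) v w \<or>
        sees V (coord K True \<circ> g) (coord K False \<circ> g) v w)"
    if "v \<in> V" "w \<in> V" "v \<noteq> w" for v w
  proof
    from that obtain a b where ab: "v = stamp a" "w = stamp b" "a \<in> nodes s" "b \<in> nodes s" "a \<noteq> b"
      by (auto simp: V_def)
    show "apart (coord K False \<circ> g) (coord K True \<circ> g) v w"
      using nodes_apart[OF K_def ab(3-5), of True] by (simp add: apart_def ab)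
    have "sees V (coord K False \<circ> g) (coord K True \<circ> g) v w \<longleftrightarrow> joined True a b"
      using sees_iff_joined[OF K_def ab(3-5), of True] ab inj
      by (simp add: V_def sees_image inj_on_subset)
    moreover have "sees V (coord K True \<circ> g) (coord K False \<circ> g) v w \<longleftrightarrow> joined False a b"
      using sees_iff_joined[OF K_def ab(3-5), of False] ab inj
      by (simp add: V_def sees_image inj_on_subset)
    moreover have "{v, w} \<in> E \<longleftrightarrow> a \<noteq> [] \<and> parent a = b \<or> b \<noteq> [] \<and> parent b = a"
      using ab(3,4) unfolding E ab(1,2) image_iff Bex_def doubleton_eq_iff stamp_eq_iff by auto
    moreover have "(\<exists>c. joined c a b) \<longleftrightarrow> joined True a b \<or> joined False a b"
      by (metis (full_types))
    ultimately show "{v, w} \<in> E \<longleftrightarrow> sees V (coord K False \<circ> g) (coord K True \<circ> g) v w \<or>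
        sees V (coord K True \<circ> g) (coord K False \<circ> g) v w"
      using joined_iff[of a b] ab by (simp add: nodes_def)
  qed
  moreover have "simple_graph V E" using rt by (simp add: rooted_tree_def)
  ultimately have "card E = (\<Sum>n=1..s. top_count n)" "depth V E 0 = s" "urvg V E"
    unfolding urvg_iff by blast+
  then show ?thesis using rt by blast
qed

theorem corollary6p3:
  fixes s :: nat and M :: real
  assumes "s \<ge> 1"
  defines "M \<equiv> - 2 + (1 - 3 / sqrt 17) * (1 / 2 * (5 - sqrt 17)) ^ s
                   + (1 + 3 / sqrt 17) * (1 / 2 * (5 + sqrt 17)) ^ s"
  shows "(\<exists>(V :: nat set) E r.
            rooted_tree V E r \<and> depth V E r = s \<and> urvg V E \<and> real (card E) = M) \<and>
         (\<forall>(V :: 'a set) E r.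
            rooted_tree V E r \<and> depth V E r = s \<and> urvg V E \<longrightarrow> real (card E) \<le> M)"
proof -
  have M: "M = real (\<Sum>n=1..s. top_count n)"
    unfolding M_def using sum_top_count[of s] by simp
  show ?thesis
  proof (intro conjI allI impI)
    show "\<exists>(V :: nat set) E r. rooted_tree V E r \<and> depth V E r = s \<and> urvg V E \<and> real (card E) = M"
      unfolding M of_nat_eq_iff using extremal_tree[OF assms(1)] .
  next
    fix V :: "'a set" and E r
    assume "rooted_tree V E r \<and> depth V E r = s \<and> urvg V E"
    then show "real (card E) \<le> M"
      unfolding M of_nat_le_iff using urvg_card_le[of V E r] by auto
  qed
qed

end
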